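(* Let $\mathfrak g$ be a three-dimensional unimodular real Lie algebra and $(H,g,\delta=0)$ a divergence-free generalized Einstein structure on $\mathfrak g$. Then, up to isomorphism, $(\mathfrak g,H,g)$ belongs to one of the following classes. (1) $\mathfrak g$ is abelian and $H=0$. The metric $g$ is flat, of any signature. (2) $\mathfrak g$ is simple, $H\ne0$ and $g$ has non-zero constant curvature. The metric $g$ is definite if and only if $\mathfrak g\cong\mathfrak{so}(3)$, and indefinite if and only if $\mathfrak g\cong\mathfrak{so}(2,1)$. (3) $H=0$, $g$ is flat and $\mathfrak g$ is one of the metabelian Lie algebras $\mathfrak e(2)$ or $\mathfrak e(1,1)$. The metric $g$ is definite on $[\mathfrak g,\mathfrak g]$ if and only if $\mathfrak g\cong\mathfrak e(2)$. (4) $\mathfrak g\cong\mathfrak{heis}$ is the Heisenberg algebra, $H=0$ and $g$ is flat and indefinite. Moreover the Lie algebras $\mathbb R^3,\mathfrak{so}(3),\mathfrak{so}(2,1),\mathfrak e(2),\mathfrak e(1,1),\mathfrak{heis}$ occurring in this list are precisely all three-dimensional unimodular real Lie algebras (up to isomorphism).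
   Context: A Lie algebra is unimodular if $\mathrm{tr}\,\mathrm{ad}_X=0$ for all $X$. $\mathfrak e(p,q)=\mathfrak{so}(p,q)\ltimes\mathbb R^{p,q}$ is the Lie algebra of the isometry group of $\mathbb R^{p,q}$, and $\mathfrak e(2)=\mathfrak e(2,0)$. A non-degenerate symmetric bilinear form $g$ on $\mathfrak g$ is identified with a left-invariant pseudo-Riemannian metric on a Lie group with Lie algebra $\mathfrak g$; flatness and constant curvature refer to the latter. Let $E=\mathfrak g\oplus\mathfrak g^*$, with scalar product $\langle X+\xi,Y+\eta\rangle=\frac12(\xi(Y)+\eta(X))$. For $H\in\bigwedge^3\mathfrak g^*$ (automatically closed when $\dim\mathfrak g=3$) the Dorfman bracket is $[X+\xi,Y+\eta]_H=[X,Y]-\mathrm{ad}_X^*\eta+\mathrm{ad}_Y^*\xi+H(X,Y,\cdot)$, where $\mathrm{ad}_X^*\eta=\eta\circ\mathrm{ad}_X$. Put $gX=g(X,\cdot)$ and $E_\pm=\{X\pm gX:X\in\mathfrak g\}$. A left-invariant generalized connection is a linear map $D:E\to\mathfrak{so}(E)$, $u\mapsto D_u$. Its torsion is $T(u,v)=D_uv-D_vu-[u,v]_H+(Du)^*v$, where $Du$ is $w\mapsto D_wu$ and $*$ is the adjoint for $\langle\cdot,\cdot\rangle$. $D$ is Levi-Civita if $T=0$ and $D_uE_\pm\subset E_\pm$ for all $u$. Its divergence is $\delta_D(v)=\mathrm{tr}(u\mapsto D_uv)$. Given $\delta\in E^*$, choose a Levi-Civita $D$ with $\delta_D=\delta$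 (one exists), put $R(u,v)w=D_uD_vw-D_vD_uw-D_{[u,v]_H}w$ and, for $u_\pm\in E_\pm$, $Ric^+_\delta(u_-,u_+)=\mathrm{tr}(E_+\ni w\mapsto R(w,u_-)u_+\in E_+)$, $Ric^-_\delta(u_+,u_-)=\mathrm{tr}(E_-\ni w\mapsto R(w,u_+)u_-\in E_-)$; these are known to be independent of the choice of $D$. A generalized Einstein structure on $\mathfrak g$ is a triple $(H,g,\delta)$ with $H\in\bigwedge^3\mathfrak g^*$, $g\in\mathrm{Sym}^2\mathfrak g^*$ non-degenerate and $\delta\in E^*$ such that $Ric^+_\delta=0$ and $Ric^-_\delta=0$. It is divergence-free if $\delta=0$. *)

theory Defs
  imports "HOL-Analysis.Analysis"
begin

section \<open>Lie algebras carried by a subspace\<close>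

definition lie_algebra :: "'v::real_vector set \<Rightarrow> ('v \<Rightarrow> 'v \<Rightarrow> 'v) \<Rightarrow> bool" where
  "lie_algebra V br \<longleftrightarrow> subspace V \<and>
     (\<forall>x\<in>V. \<forall>y\<in>V. br x y \<in> V) \<and>
     (\<forall>x\<in>V. \<forall>y\<in>V. \<forall>z\<in>V. br (x + y) z = br x z + br y z \<and> br x (y + z) = br x y + br x z) \<and>
     (\<forall>x\<in>V. \<forall>y\<in>V. \<forall>c::real. br (c *\<^sub>R x) y = c *\<^sub>R br x y \<and> br x (c *\<^sub>R y) = c *\<^sub>R br x y) \<and>
     (\<forall>x\<in>V. br x x = 0) \<and>
     (\<forall>x\<in>V. \<forall>y\<in>V. \<forall>z\<in>V. br x (br y z) + br y (br z x) + br z (br x y) = 0)"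

definition lie_isomorphic ::
  "'v::real_vector set \<Rightarrow> ('v \<Rightarrow> 'v \<Rightarrow> 'v) \<Rightarrow> 'w::real_vector set \<Rightarrow> ('w \<Rightarrow> 'w \<Rightarrow> 'w) \<Rightarrow> bool" where
  "lie_isomorphic V br W br' \<longleftrightarrow> (\<exists>f. bij_betw f V W \<and>
     (\<forall>x\<in>V. \<forall>y\<in>V. f (x + y) = f x + f y) \<and>
     (\<forall>x\<in>V. \<forall>c::real. f (c *\<^sub>R x) = c *\<^sub>R f x) \<and>
     (\<forall>x\<in>V. \<forall>y\<in>V. f (br x y) = br' (f x) (f y)))"

text \<open>The trace of an endomorphism \<open>f\<close> of a finite-dimensional subspace \<open>V\<close>: the sum of the
  diagonal entries in a basis of \<open>V\<close>. It does not depend on the basis.\<close>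

definition endo_trace :: "'v::real_vector set \<Rightarrow> ('v \<Rightarrow> 'v) \<Rightarrow> real" where
  "endo_trace V f =
     (let B = (SOME B. independent B \<and> span B = V) in \<Sum>b\<in>B. representation B (f b) b)"

definition unimodular :: "'v::real_vector set \<Rightarrow> ('v \<Rightarrow> 'v \<Rightarrow> 'v) \<Rightarrow> bool" where
  "unimodular V br \<longleftrightarrow> (\<forall>x\<in>V. endo_trace V (br x) = 0)"

definition lie_abelian :: "'v::real_vector set \<Rightarrow> ('v \<Rightarrow> 'v \<Rightarrow> 'v) \<Rightarrow> bool" where
  "lie_abelian V br \<longleftrightarrow> (\<forall>x\<in>V. \<forall>y\<in>V. br x y = 0)"

definition lie_ideal :: "'v::real_vector set \<Rightarrow> 'v set \<Rightarrow> ('v \<Rightarrow> 'v \<Rightarrow> 'v) \<Rightarrow> bool" where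
  "lie_ideal I V br \<longleftrightarrow> subspace I \<and> I \<subseteq> V \<and> (\<forall>x\<in>V. \<forall>y\<in>I. br x y \<in> I)"

definition lie_simple :: "'v::real_vector set \<Rightarrow> ('v \<Rightarrow> 'v \<Rightarrow> 'v) \<Rightarrow> bool" where
  "lie_simple V br \<longleftrightarrow> \<not> lie_abelian V br \<and> (\<forall>I. lie_ideal I V br \<longrightarrow> I = {0} \<or> I = V)"

definition derived_algebra :: "'v::real_vector set \<Rightarrow> ('v \<Rightarrow> 'v \<Rightarrow> 'v) \<Rightarrow> 'v set" where
  "derived_algebra V br = span {br x y | x y. x \<in> V \<and> y \<in> V}"

definition metabelian :: "'v::real_vector set \<Rightarrow> ('v \<Rightarrow> 'v \<Rightarrow> 'v) \<Rightarrow> bool" where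
  "metabelian V br \<longleftrightarrow> lie_abelian (derived_algebra V br) br"


section \<open>The Lie algebras of the list\<close>

definition zero_bracket :: "'v::zero \<Rightarrow> 'v \<Rightarrow> 'v" where
  "zero_bracket x y = 0"

definition commutator :: "real^'n^'n \<Rightarrow> real^'n^'n \<Rightarrow> real^'n^'n" where
  "commutator A B = A ** B - B ** A"

definition diag_matrix :: "real^'n \<Rightarrow> real^'n^'n" where
  "diag_matrix s = (\<chi> i j. if i = j then s $ i else 0)"

text \<open>\<open>so_alg s\<close> is \<open>so(p,q)\<close> for a vector \<open>s\<close> of \<open>p\<close> entries \<open>1\<close> and \<open>q\<close> entries \<open>-1\<close>, the diagonal
  of the Gram matrix of \<open>R^{p,q}\<close>; \<open>e_alg s\<close> is then \<open>e(p,q)\<close>.\<close>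

definition so_alg :: "real^'n \<Rightarrow> (real^'n^'n) set" where
  "so_alg s = {A. transpose A ** diag_matrix s + diag_matrix s ** A = 0}"

definition e_alg :: "real^'n \<Rightarrow> ((real^'n^'n) \<times> (real^'n)) set" where
  "e_alg s = so_alg s \<times> UNIV"

definition e_bracket ::
  "(real^'n^'n) \<times> (real^'n) \<Rightarrow> (real^'n^'n) \<times> (real^'n) \<Rightarrow> (real^'n^'n) \<times> (real^'n)" where
  "e_bracket a b = (commutator (fst a) (fst b), fst a *v snd b - fst b *v snd a)"

abbreviation so3 :: "(real^3^3) set" where
  "so3 \<equiv> so_alg (vector [1, 1, 1])"

abbreviation so21 :: "(real^3^3) set" where
  "so21 \<equiv> so_alg (vector [1, 1, -1])"

abbreviation e2 :: "((real^2^2) \<times> (real^2)) set" where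
  "e2 \<equiv> e_alg (vector [1, 1])"

abbreviation e11 :: "((real^2^2) \<times> (real^2)) set" where
  "e11 \<equiv> e_alg (vector [1, -1])"

definition heis :: "(real^3^3) set" where
  "heis = {vector [vector [0, a, c], vector [0, 0, b], vector [0, 0, 0]] | a b c. True}"


section \<open>Left-invariant pseudo-Riemannian metrics\<close>

definition pseudo_metric :: "('a::real_vector \<Rightarrow> 'a \<Rightarrow> real) \<Rightarrow> bool" where
  "pseudo_metric g \<longleftrightarrow> bilinear g \<and> (\<forall>x y. g x y = g y x) \<and> (\<forall>x. (\<forall>y. g x y = 0) \<longrightarrow> x = 0)"

definition definite_on :: "'a::real_vector set \<Rightarrow> ('a \<Rightarrow> 'a \<Rightarrow> real) \<Rightarrow> bool" where
  "definite_on V g \<longleftrightarrow> (\<forall>x\<in>V. x \<noteq> 0 \<longrightarrow> g x x > 0) \<or> (\<forall>x\<in>V. x \<noteq> 0 \<longrightarrow> g x x < 0)"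

definition indefinite :: "('a::real_vector \<Rightarrow> 'a \<Rightarrow> real) \<Rightarrow> bool" where
  "indefinite g \<longleftrightarrow> (\<exists>x. g x x > 0) \<and> (\<exists>x. g x x < 0)"

text \<open>The Levi-Civita connection and the curvature tensor of a left-invariant metric are determined
  by their values on left-invariant vector fields, that is, by the following maps on the Lie algebra.
  The Levi-Civita connection exists and is unique.\<close>

definition levi_civita ::
  "('a::real_vector \<Rightarrow> 'a \<Rightarrow> 'a) \<Rightarrow> ('a \<Rightarrow> 'a \<Rightarrow> real) \<Rightarrow> ('a \<Rightarrow> 'a \<Rightarrow> 'a) \<Rightarrow> bool" where
  "levi_civita br g nabla \<longleftrightarrow> bilinear nabla \<and>
     (\<forall>x y. nabla x y - nabla y x = br x y) \<and>
     (\<forall>x y z. g (nabla x y) z + g y (nabla x z) = 0)"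

definition curvature ::
  "('a::real_vector \<Rightarrow> 'a \<Rightarrow> 'a) \<Rightarrow> ('a \<Rightarrow> 'b::real_vector \<Rightarrow> 'b) \<Rightarrow> 'a \<Rightarrow> 'a \<Rightarrow> 'b \<Rightarrow> 'b" where
  "curvature br nabla x y z = nabla x (nabla y z) - nabla y (nabla x z) - nabla (br x y) z"

definition constant_curvature ::
  "('a::real_vector \<Rightarrow> 'a \<Rightarrow> 'a) \<Rightarrow> ('a \<Rightarrow> 'a \<Rightarrow> real) \<Rightarrow> real \<Rightarrow> bool" where
  "constant_curvature br g c \<longleftrightarrow> (\<exists>nabla. levi_civita br g nabla \<and>
     (\<forall>x y z. curvature br nabla x y z = c *\<^sub>R (g y z *\<^sub>R x - g x z *\<^sub>R y)))"

definition flat_metric :: "('a::real_vector \<Rightarrow> 'a \<Rightarrow> 'a) \<Rightarrow> ('a \<Rightarrow> 'a \<Rightarrow> real) \<Rightarrow> bool" where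
  "flat_metric br g \<longleftrightarrow> (\<exists>nabla. levi_civita br g nabla \<and>
     (\<forall>x y z. curvature br nabla x y z = 0))"


section \<open>Generalized geometry on \<open>E = g + g^*\<close>\<close>

text \<open>As the Lie algebra is finite-dimensional, its dual space is the space of bounded linear
  functionals, and \<open>Blinfun\<close> turns any linear functional into an element of it.\<close>

type_synonym 'a gen = "'a \<times> ('a \<Rightarrow>\<^sub>L real)"

definition three_form :: "('a::real_vector \<Rightarrow> 'a \<Rightarrow> 'a \<Rightarrow> real) \<Rightarrow> bool" where
  "three_form H \<longleftrightarrow>
     (\<forall>x y. linear (\<lambda>z. H x y z)) \<and> (\<forall>x z. linear (\<lambda>y. H x y z)) \<and> (\<forall>y z. linear (\<lambda>x. H x y z)) \<and>
     (\<forall>x y. H x x y = 0 \<and> H x y x = 0 \<and> H y x x = 0)"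

definition pairing :: "'a::euclidean_space gen \<Rightarrow> 'a gen \<Rightarrow> real" where
  "pairing u v = (blinfun_apply (snd u) (fst v) + blinfun_apply (snd v) (fst u)) / 2"

definition coad :: "('a::euclidean_space \<Rightarrow> 'a \<Rightarrow> 'a) \<Rightarrow> 'a \<Rightarrow> ('a \<Rightarrow>\<^sub>L real) \<Rightarrow> ('a \<Rightarrow>\<^sub>L real)" where
  "coad br x \<eta> = Blinfun (\<lambda>z. blinfun_apply \<eta> (br x z))"

definition dorfman ::
  "('a::euclidean_space \<Rightarrow> 'a \<Rightarrow> 'a) \<Rightarrow> ('a \<Rightarrow> 'a \<Rightarrow> 'a \<Rightarrow> real) \<Rightarrow> 'a gen \<Rightarrow> 'a gen \<Rightarrow> 'a gen" where
  "dorfman br H u v =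
     (br (fst u) (fst v),
      - coad br (fst u) (snd v) + coad br (fst v) (snd u) + Blinfun (H (fst u) (fst v)))"

definition E_plus :: "('a::euclidean_space \<Rightarrow> 'a \<Rightarrow> real) \<Rightarrow> 'a gen set" where
  "E_plus g = range (\<lambda>x. (x, Blinfun (g x)))"

definition E_minus :: "('a::euclidean_space \<Rightarrow> 'a \<Rightarrow> real) \<Rightarrow> 'a gen set" where
  "E_minus g = range (\<lambda>x. (x, - Blinfun (g x)))"

definition pairing_adjoint ::
  "('a::euclidean_space gen \<Rightarrow> 'a gen) \<Rightarrow> 'a gen \<Rightarrow> 'a gen" where
  "pairing_adjoint F v = (THE z. \<forall>w. pairing z w = pairing v (F w))"

definition gen_connection :: "('a::euclidean_space gen \<Rightarrow> 'a gen \<Rightarrow> 'a gen) \<Rightarrow> bool" where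
  "gen_connection D \<longleftrightarrow> bilinear D \<and> (\<forall>u v w. pairing (D u v) w + pairing v (D u w) = 0)"

definition gen_torsion ::
  "('a::euclidean_space \<Rightarrow> 'a \<Rightarrow> 'a) \<Rightarrow> ('a \<Rightarrow> 'a \<Rightarrow> 'a \<Rightarrow> real) \<Rightarrow>
   ('a gen \<Rightarrow> 'a gen \<Rightarrow> 'a gen) \<Rightarrow> 'a gen \<Rightarrow> 'a gen \<Rightarrow> 'a gen" where
  "gen_torsion br H D u v =
     D u v - D v u - dorfman br H u v + pairing_adjoint (\<lambda>w. D w u) v"

definition gen_levi_civita ::
  "('a::euclidean_space \<Rightarrow> 'a \<Rightarrow> 'a) \<Rightarrow> ('a \<Rightarrow> 'a \<Rightarrow> 'a \<Rightarrow> real) \<Rightarrow> ('a \<Rightarrow> 'a \<Rightarrow> real) \<Rightarrow>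
   ('a gen \<Rightarrow> 'a gen \<Rightarrow> 'a gen) \<Rightarrow> bool" where
  "gen_levi_civita br H g D \<longleftrightarrow> gen_connection D \<and>
     (\<forall>u v. gen_torsion br H D u v = 0) \<and>
     (\<forall>u. D u ` E_plus g \<subseteq> E_plus g \<and> D u ` E_minus g \<subseteq> E_minus g)"

definition gen_divergence :: "('a::euclidean_space gen \<Rightarrow> 'a gen \<Rightarrow> 'a gen) \<Rightarrow> 'a gen \<Rightarrow> real" where
  "gen_divergence D v = endo_trace UNIV (\<lambda>u. D u v)"

definition Ric_plus ::
  "('a::euclidean_space \<Rightarrow> 'a \<Rightarrow> 'a) \<Rightarrow> ('a \<Rightarrow> 'a \<Rightarrow> 'a \<Rightarrow> real) \<Rightarrow> ('a \<Rightarrow> 'a \<Rightarrow> real) \<Rightarrow>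
   ('a gen \<Rightarrow> 'a gen \<Rightarrow> 'a gen) \<Rightarrow> 'a gen \<Rightarrow> 'a gen \<Rightarrow> real" where
  "Ric_plus br H g D u v = endo_trace (E_plus g) (\<lambda>w. curvature (dorfman br H) D w u v)"

definition Ric_minus ::
  "('a::euclidean_space \<Rightarrow> 'a \<Rightarrow> 'a) \<Rightarrow> ('a \<Rightarrow> 'a \<Rightarrow> 'a \<Rightarrow> real) \<Rightarrow> ('a \<Rightarrow> 'a \<Rightarrow> real) \<Rightarrow>
   ('a gen \<Rightarrow> 'a gen \<Rightarrow> 'a gen) \<Rightarrow> 'a gen \<Rightarrow> 'a gen \<Rightarrow> real" where
  "Ric_minus br H g D u v = endo_trace (E_minus g) (\<lambda>w. curvature (dorfman br H) D w u v)"

text \<open>A Levi-Civita generalized connection with divergence \<open>\<delta>\<close> always exists, and the two Ricci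
  tensors depend on it only through \<open>\<delta>\<close>, so any choice of \<open>D\<close> may serve as witness.\<close>

definition gen_einstein ::
  "('a::euclidean_space \<Rightarrow> 'a \<Rightarrow> 'a) \<Rightarrow> ('a \<Rightarrow> 'a \<Rightarrow> 'a \<Rightarrow> real) \<Rightarrow> ('a \<Rightarrow> 'a \<Rightarrow> real) \<Rightarrow>
   ('a gen \<Rightarrow>\<^sub>L real) \<Rightarrow> bool" where
  "gen_einstein br H g \<delta> \<longleftrightarrow> three_form H \<and> pseudo_metric g \<and>
     (\<exists>D. gen_levi_civita br H g D \<and>
          (\<forall>v. gen_divergence D v = blinfun_apply \<delta> v) \<and>
          (\<forall>u\<in>E_minus g. \<forall>v\<in>E_plus g. Ric_plus br H g D u v = 0) \<and>
          (\<forall>u\<in>E_plus g. \<forall>v\<in>E_minus g. Ric_minus br H g D u v = 0))"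

end

theory Submission
  imports Defs
begin

text \<open>For the cross product of \<open>g\<close>, a unimodular bracket is \<open>[x, y] = L (x \<times> y)\<close> with \<open>L\<close>
  self-adjoint. With \<open>M = tr L / 2 - L\<close> and \<open>H = h vol\<close>, the metric connections with torsion
  \<open>\<plusminus>H\<close> are \<open>x, y \<mapsto> (M \<plusminus> h/2) x \<times> y\<close>. The mixed type parts of a Levi-Civita generalized
  connection are given by these two connections, and if its divergence vanishes then the remaining
  parts do not contribute to the Ricci curvature. The Einstein equation becomes
  \<open>adj M = (h/2)\<^sup>2 I\<close>. If \<open>h \<noteq> 0\<close>, then \<open>M\<close> and \<open>L\<close> are non-zero multiples of the identity. If
  \<open>h = 0\<close>, then \<open>M = c v \<otimes> g v\<close>, the metric is flat, and the Lie algebra is abelian for \<open>M = 0\<close>, the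
  Heisenberg algebra if \<open>v\<close> is null, and \<open>e(2)\<close> or \<open>e(1,1)\<close> otherwise. The list of all unimodular
  algebras results from diagonalising the quadratic form \<open>g (L x) x\<close> for an auxiliary metric.\<close>

section \<open>Traces and orthogonal bases\<close>

text \<open>Why the Einstein equation takes the form \<open>adj M = (h/2)\<^sup>2 I\<close>: write
  \<open>[u]\<close> for the operator \<open>w \<mapsto> u \<times> w\<close>. The Ricci tensor is,
  up to sign, the trace of \<open>[v] (M + h/2) [u] (M - h/2)\<close>. Since \<open>M\<close> is
  self-adjoint, \<open>M [u] M = [adj M u]\<close>. The terms linear in \<open>h\<close> combine to
  a multiple of the trace of \<open>([v] [u] - [u] [v]) M\<close>, which vanishes because the
  commutator is skew and \<open>M\<close> is self-adjoint. What remains is the trace of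
  \<open>[v] [adj M u - (h/2)\<^sup>2 u]\<close>, a non-zero multiple of
  \<open>g v (adj M u - (h/2)\<^sup>2 u)\<close>. The equation is therefore solved through the
  minors of \<open>M\<close> in a pseudo-orthonormal frame with symbolic signs, and the normal form
  of the bracket comes from diagonalising a bilinear form, which is possible in every
  signature.\<close>

lemma endo_trace_eq:
  fixes V :: "'v::real_vector set" and \<phi> :: "'i \<Rightarrow> 'v \<Rightarrow> real"
  assumes I: "finite I" and sp: "span (e ` I) = V"
    and lin: "\<And>i. i \<in> I \<Longrightarrow> linear (\<phi> i)"
    and dual: "\<And>i j. i \<in> I \<Longrightarrow> j \<in> I \<Longrightarrow> \<phi> i (e j) = (if i = j then 1 else 0)"
    and fV: "\<And>x. x \<in> V \<Longrightarrow> f x \<in> V"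
    and fadd: "\<And>x y. x \<in> V \<Longrightarrow> y \<in> V \<Longrightarrow> f (x + y) = f x + f y"
    and fscale: "\<And>c x. x \<in> V \<Longrightarrow> f (c *\<^sub>R x) = c *\<^sub>R f x"
  shows "endo_trace V f = (\<Sum>i\<in>I. \<phi> i (f (e i)))"
proof -
  have V: "subspace V" using sp subspace_span by metis
  have eV: "e i \<in> V" if "i \<in> I" for i using sp that by (metis image_eqI span_base)
  have expand: "x = (\<Sum>i\<in>I. \<phi> i x *\<^sub>R e i)" if "x \<in> V" for x
  proof (rule linear_eq_on_span[where f="\<lambda>x. x" and g="\<lambda>x. \<Sum>i\<in>I. \<phi> i x *\<^sub>R e i" and B="e ` I"])
    show "linear (\<lambda>x. \<Sum>i\<in>I. \<phi> i x *\<^sub>R e i)"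
      by (intro linear_compose_sum ballI linearI)
        (auto simp: linear_add[OF lin] linear_scale[OF lin] scaleR_left_distrib)
    show "x \<in> span (e ` I)" using that sp by simp
    fix y assume "y \<in> e ` I"
    then obtain j where j: "j \<in> I" "y = e j" by auto
    have "(\<Sum>i\<in>I. \<phi> i y *\<^sub>R e i) = (\<Sum>i\<in>I. if i = j then e i else 0)"
      by (rule sum.cong) (auto simp: j dual)
    then show "y = (\<Sum>i\<in>I. \<phi> i y *\<^sub>R e i)" using I j by simp
  qed (simp add: linear_ident)
  have f0: "f 0 = 0" using fscale[of 0 0] V by (simp add: subspace_0)
  have fsum: "f (\<Sum>i\<in>J. c i *\<^sub>R e i) = (\<Sum>i\<in>J. c i *\<^sub>R f (e i))"
    if "finite J" "J \<subseteq> I" for J c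
    using that
  proof (induction J rule: finite_induct)
    case (insert i J)
    have "(\<Sum>i\<in>J. c i *\<^sub>R e i) \<in> V"
      using insert eV V by (intro subspace_sum subspace_scale) auto
    then show ?case using insert eV V
      by (simp add: fadd fscale subspace_scale)
  qed (simp add: f0)
  define B where "B = (SOME B. independent B \<and> span B = V)"
  obtain B' where "B' \<subseteq> V" "independent B'" "V \<subseteq> span B'" by (rule maximal_independent_subset)
  then have "independent B' \<and> span B' = V" using V span_subspace by blast
  then have "independent B \<and> span B = V" unfolding B_def by (rule someI)
  then have B: "independent B" "span B = V" by auto
  have finB: "finite B"
    using independent_span_bound[of "e ` I" B] I B sp span_superset[of B] by auto
  have "representation B (f b) b = (\<Sum>i\<in>I. \<phi> i b * representation B (f (e i)) b)" if "b \<in> B" for b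
  proof -
    have bV: "b \<in> V" using that B span_base by blast
    have "f b = (\<Sum>i\<in>I. \<phi> i b *\<^sub>R f (e i))"
      using fsum[OF I order.refl, of "\<lambda>i. \<phi> i b"] expand[OF bV] by simp
    moreover have "f (e i) \<in> span B" if "i \<in> I" for i using that eV fV B by auto
    moreover have "representation B (\<Sum>i\<in>I. \<phi> i b *\<^sub>R f (e i)) b =
        (\<Sum>i\<in>I. representation B (\<phi> i b *\<^sub>R f (e i)) b)"
      using B calculation(2) by (subst representation_sum) (auto intro: span_scale)
    ultimately show ?thesis
      by (simp add: representation_scale B)
  qed
  \<comment> \<open>Basis independence as one double sum: each \<open>b\<close> has been expanded in
    the \<open>e i\<close>, and after swapping the sums each \<open>f (e i)\<close> is reassembled
    from its coordinates in \<open>B\<close>.\<close>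
  then have "endo_trace V f = (\<Sum>b\<in>B. \<Sum>i\<in>I. \<phi> i b * representation B (f (e i)) b)"
    by (simp add: endo_trace_def B_def[symmetric] Let_def)
  also have "\<dots> = (\<Sum>i\<in>I. \<Sum>b\<in>B. \<phi> i b * representation B (f (e i)) b)"
    by (rule sum.swap)
  also have "\<dots> = (\<Sum>i\<in>I. \<phi> i (\<Sum>b\<in>B. representation B (f (e i)) b *\<^sub>R b))"
    by (rule sum.cong) (auto simp: linear_sum[OF lin] linear_scale[OF lin] mult.commute)
  also have "\<dots> = (\<Sum>i\<in>I. \<phi> i (f (e i)))"
    by (rule sum.cong) (use sum_representation_eq[OF B(1) _ finB order.refl] B eV fV in auto)
  finally show ?thesis .
qed

lemma endo_trace_UNIV:
  fixes f :: "'a::euclidean_space \<Rightarrow> 'a"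
  assumes "linear f"
  shows "endo_trace UNIV f = (\<Sum>b\<in>Basis. f b \<bullet> b)"
  by (rule endo_trace_eq[where e="\<lambda>b. b" and \<phi>="\<lambda>b x. x \<bullet> b"])
    (auto simp: inner_Basis linear_add[OF assms] linear_scale[OF assms] inner_add_left intro!: linearI)

lemma endo_trace_basis3:
  assumes sp: "span {x, y, z} = V"
    and lin: "linear p" "linear q" "linear r"
    and dual: "p x = (1::real)" "p y = 0" "p z = 0" "q x = (0::real)" "q y = 1" "q z = 0"
       "r x = (0::real)" "r y = 0" "r z = 1"
    and fV: "\<And>x. x \<in> V \<Longrightarrow> f x \<in> V"
    and fadd: "\<And>x y. x \<in> V \<Longrightarrow> y \<in> V \<Longrightarrow> f (x + y) = f x + f y"
    and fscale: "\<And>c x. x \<in> V \<Longrightarrow> f (c *\<^sub>R x) = c *\<^sub>R f x"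
  shows "endo_trace V f = p (f x) + q (f y) + r (f z)"
proof -
  let ?e = "\<lambda>i::nat. if i = 0 then x else if i = 1 then y else z"
  let ?\<phi> = "\<lambda>i::nat. if i = 0 then p else if i = 1 then q else r"
  have "endo_trace V f = (\<Sum>i\<in>{0,1,2}. ?\<phi> i (f (?e i)))"
  proof (rule endo_trace_eq)
    show "span (?e ` {0, 1, 2}) = V" using sp by (simp add: insert_commute)
  qed (use assms(2-) in auto)
  then show ?thesis by simp
qed

text \<open>\<open>B\<close> may be degenerate, as is needed later for the form
  \<open>g (L x) y\<close>. If the quadratic form vanishes on \<open>S\<close>, polarisation makes
  \<open>B\<close> vanish there and any basis will do; otherwise a vector \<open>v\<close> with
  \<open>B v v \<noteq> 0\<close> splits off, and the induction continues on its orthogonal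
  complement in \<open>S\<close>.\<close>

lemma exists_orthogonal_basis:
  fixes B :: "'a::euclidean_space \<Rightarrow> 'a \<Rightarrow> real"
  assumes B: "bilinear B" and sym: "\<And>x y. B x y = B y x" and S: "subspace S"
  shows "\<exists>C. independent C \<and> span C = S \<and> (\<forall>x\<in>C. \<forall>y\<in>C. x \<noteq> y \<longrightarrow> B x y = 0)"
  using S
proof (induction "dim S" arbitrary: S rule: less_induct)
  case less
  show ?case
  proof (cases "\<forall>x\<in>S. B x x = 0")
    case True
    have B0: "B x y = 0" if "x \<in> S" "y \<in> S" for x y
    proof -
      have "B (x + y) (x + y) = 0" using True that less.prems by (simp add: subspace_add)
      then show ?thesis using True that sym[of y x]
        by (simp add: bilinear_ladd[OF B] bilinear_radd[OF B])
    qed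
    obtain C where C: "C \<subseteq> S" "independent C" "S \<subseteq> span C" by (rule maximal_independent_subset)
    show ?thesis
    proof (intro exI conjI ballI impI)
      show "span C = S" by (rule span_subspace[OF C(1,3) less.prems])
      show "B x y = 0" if "x \<in> C" "y \<in> C" for x y using that C(1) by (intro B0) blast+
    qed (rule C(2))
  next
    case False
    then obtain v where v: "v \<in> S" "B v v \<noteq> 0" by blast
    define T where "T = {x \<in> S. B x v = 0}"
    have T: "subspace T" using less.prems
      by (auto simp: T_def subspace_def bilinear_lzero[OF B] bilinear_ladd[OF B] bilinear_lmul[OF B])
    have "T \<subset> S" using v by (auto simp: T_def)
    then have "dim T < dim S"
      using T less.prems dim_psubset[of T S] by (simp add: span_eq_iff[THEN iffD2])
    then obtain C where C: "independent C" "span C = T" "\<forall>x\<in>C. \<forall>y\<in>C. x \<noteq> y \<longrightarrow> B x y = 0"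
      using less.hyps T by blast
    have CT: "C \<subseteq> T" using C span_superset by blast
    have "v \<notin> T" using v by (simp add: T_def)
    then have "independent (insert v C)" using C by (simp add: independent_insert)
    moreover have "span (insert v C) = S"
    proof (rule span_subspace)
      show "insert v C \<subseteq> S" using v CT by (auto simp: T_def)
      show "S \<subseteq> span (insert v C)"
      proof
        fix x assume x: "x \<in> S"
        have "x - (B x v / B v v) *\<^sub>R v \<in> T"
          using x v less.prems
          by (simp add: T_def subspace_diff subspace_scale bilinear_lsub[OF B] bilinear_lmul[OF B])
        then show "x \<in> span (insert v C)" using C by (auto simp: span_insert)
      qed
    qed (use less.prems in auto)
    moreover have "\<forall>x\<in>insert v C. \<forall>y\<in>insert v C. x \<noteq> y \<longrightarrow> B x y = 0"
      using C CT sym by (auto simp: T_def)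
    ultimately show ?thesis by blast
  qed
qed

lemma exists_orthogonal_basis3:
  fixes B :: "'a::euclidean_space \<Rightarrow> 'a \<Rightarrow> real"
  assumes "DIM('a) = 3" "bilinear B" "\<And>x y. B x y = B y x"
  obtains x y z where "span {x, y, z} = UNIV" "B x y = 0" "B y z = 0" "B z x = 0"
proof -
  obtain C where C: "independent C" "span C = (UNIV::'a set)"
      "\<forall>x\<in>C. \<forall>y\<in>C. x \<noteq> y \<longrightarrow> B x y = 0"
    using exists_orthogonal_basis[of B UNIV] assms by auto
  have "card C = dim (span C)" using C(1) by (simp add: dim_eq_card_independent)
  then have "card C = 3" using assms(1) C(2) by simp
  then obtain x y z where "C = {x, y, z}" "x \<noteq> y" "y \<noteq> z" "x \<noteq> z" by (auto simp: card_3_iff)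
  then show ?thesis using C that[of x y z] by auto
qed

section \<open>The generalized Ricci curvature\<close>

lemma lie_algebra_bilinear: "lie_algebra UNIV br \<Longrightarrow> bilinear br"
  by (auto simp: lie_algebra_def bilinear_def intro!: linearI)

lemma lie_algebra_skew:
  assumes "lie_algebra V br" "x \<in> V" "y \<in> V"
  shows "br y x = - br x y"
proof -
  have V: "subspace V" using assms by (simp add: lie_algebra_def)
  have 1: "br (x + y) (x + y) = br x (x + y) + br y (x + y)"
    "br x (x + y) = br x x + br x y" "br y (x + y) = br y x + br y y"
    using assms subspace_add[OF V] unfolding lie_algebra_def by blast+
  have 2: "br (x + y) (x + y) = 0" "br x x = 0" "br y y = 0"
    using assms subspace_add[OF V] unfolding lie_algebra_def by blast+
  have "br x y + br y x = 0" using 2(1) unfolding 1 2(2,3) by simp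
  then show ?thesis by (simp add: eq_neg_iff_add_eq_0 add.commute)
qed

section \<open>Raising an index and connections with skew torsion\<close>

lemma pseudo_metricD:
  assumes "pseudo_metric g"
  shows "bilinear g" "g x y = g y x" "(\<And>y. g x y = 0) \<Longrightarrow> x = 0"
  using assms by (auto simp: pseudo_metric_def)

lemma pseudo_metric_eqI:
  assumes g: "pseudo_metric g" and eq: "\<And>z. g x z = g y z"
  shows "x = y"
  using pseudo_metricD(3)[OF g, of "x - y"] eq
  by (simp add: bilinear_lsub[OF pseudo_metricD(1)[OF g]])

definition sharp :: "('a::euclidean_space \<Rightarrow> 'a \<Rightarrow> real) \<Rightarrow> ('a \<Rightarrow> real) \<Rightarrow> 'a" where
  "sharp g \<phi> = (SOME x. \<forall>y. g x y = \<phi> y)"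

text \<open>The inner product turns \<open>g\<close> into an endomorphism \<open>A\<close>;
  non-degeneracy says that \<open>A\<close> is injective, hence surjective in finite
  dimension.\<close>

lemma sharp:
  fixes g :: "'a::euclidean_space \<Rightarrow> 'a \<Rightarrow> real"
  assumes g: "pseudo_metric g" and \<phi>: "linear \<phi>"
  shows "g (sharp g \<phi>) y = \<phi> y"
proof -
  note bil = pseudo_metricD(1)[OF g]
  have exp: "\<psi> y = (\<Sum>b\<in>Basis. \<psi> b *\<^sub>R b) \<bullet> y" if "linear \<psi>" for \<psi> :: "'a \<Rightarrow> real" and y
  proof -
    have "\<psi> y = \<psi> (\<Sum>b\<in>Basis. (y \<bullet> b) *\<^sub>R b)" by (simp add: euclidean_representation)
    also have "\<dots> = (\<Sum>b\<in>Basis. (y \<bullet> b) * \<psi> b)"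
      using that by (simp add: linear_sum linear_scale)
    finally show ?thesis
      unfolding inner_sum_left inner_scaleR_left by (simp add: inner_commute mult.commute)
  qed
  define A where "A = (\<lambda>x. \<Sum>b\<in>Basis. g x b *\<^sub>R b)"
  have gA: "g x y = A x \<bullet> y" for x y
    unfolding A_def by (rule exp) (use bil in \<open>simp add: bilinear_def\<close>)
  have "linear A"
    by (auto simp: A_def bilinear_ladd[OF bil] bilinear_lmul[OF bil] scaleR_left_distrib
        sum.distrib scaleR_sum_right intro!: linearI)
  moreover have "inj A"
    by (rule injI, rule pseudo_metric_eqI[OF g]) (simp add: gA)
  ultimately have "surj A" by (rule linear_inj_imp_surj)
  then obtain x where x: "A x = (\<Sum>b\<in>Basis. \<phi> b *\<^sub>R b)" by (metis surjD)
  have "\<forall>y. g x y = \<phi> y" unfolding gA x by (simp only: exp[OF \<phi>, symmetric] simp_thms)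
  then show ?thesis unfolding sharp_def by (rule someI2) simp
qed

text \<open>The metric connection with skew torsion \<open>H\<close>, by Koszul's formula.\<close>

definition bismut ::
  "('a::euclidean_space \<Rightarrow> 'a \<Rightarrow> 'a) \<Rightarrow> ('a \<Rightarrow> 'a \<Rightarrow> real) \<Rightarrow> ('a \<Rightarrow> 'a \<Rightarrow> 'a \<Rightarrow> real) \<Rightarrow> 'a \<Rightarrow> 'a \<Rightarrow> 'a"
  where "bismut br g H x y =
    sharp g (\<lambda>z. (g (br x y) z - g (br y z) x + g (br z x) y + H x y z) / 2)"

lemma three_form_linear:
  assumes "three_form H"
  shows "linear (H x y)" "linear (\<lambda>y. H x y z)" "linear (\<lambda>x. H x y z)"
proof -
  have "linear (\<lambda>z. H x y z)" using assms by (simp only: three_form_def)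
  then show "linear (H x y)" by simp
qed (use assms in \<open>simp_all only: three_form_def\<close>)

lemma three_form_skew:
  assumes "three_form H"
  shows "H y x z = - H x y z" "H x z y = - H x y z" "H x x y = 0" "H x y y = 0" "H x y x = 0"
proof -
  show 0: "H x x y = 0" "H x y y = 0" "H x y x = 0" for x y using assms by (simp_all add: three_form_def)
  note L = linear_add[OF three_form_linear(1)[OF assms]] linear_add[OF three_form_linear(2)[OF assms]]
    linear_add[OF three_form_linear(3)[OF assms]]
  have "H x y z + H y x z = 0" using 0(1)[of "x + y" z] unfolding L by (simp add: 0)
  then show "H y x z = - H x y z" by linarith
  have "H x y z + H x z y = 0" using 0(2)[of x "y + z"] unfolding L by (simp add: 0)
  then show "H x z y = - H x y z" by linarith
qed

lemma three_form_uminus: "three_form H \<Longrightarrow> three_form (\<lambda>x y z. - H x y z)"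
  by (auto simp: three_form_def intro: linear_compose_neg)

lemma three_form_zero: "three_form (\<lambda>x y z. 0)"
  by (simp add: three_form_def linear_zero)

lemma pairing_nondegenerate:
  assumes "\<And>w. pairing z w = 0"
  shows "z = (0::'a::euclidean_space gen)"
proof -
  have "fst z \<bullet> fst z = 0"
    using assms[of "(0, blinfun_inner_left (fst z))"] by (simp add: pairing_def)
  moreover have "snd z = 0"
    by (rule blinfun_eqI) (use assms[of "(_, 0)"] in \<open>simp add: pairing_def\<close>)
  ultimately show ?thesis by (simp add: prod_eq_iff)
qed

text \<open>The adjoint is a definite description, so its value has to be pinned down by
  non-degeneracy of the pairing. This case covers the adjoint term in the torsion of two vectors of
  opposite type.\<close>

lemma pairing_adjoint_zero:
  assumes "\<And>w. pairing v (F w) = 0"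
  shows "pairing_adjoint F v = (0::'a::euclidean_space gen)"
  unfolding pairing_adjoint_def
proof (rule the_equality)
  show "\<forall>w. pairing 0 w = pairing v (F w)" using assms by (simp add: pairing_def)
qed (use pairing_nondegenerate assms in auto)

locale metric_lie_algebra =
  fixes br :: "'a::euclidean_space \<Rightarrow> 'a \<Rightarrow> 'a" and g :: "'a \<Rightarrow> 'a \<Rightarrow> real"
  assumes lie: "lie_algebra UNIV br" and metric: "pseudo_metric g"
begin

lemmas br_bil = lie_algebra_bilinear[OF lie]
lemmas g_bil = pseudo_metricD(1)[OF metric]
lemmas g_sym = pseudo_metricD(2)[OF metric]
lemmas eqI = pseudo_metric_eqI[OF metric]

lemmas br_simps = bilinear_ladd[OF br_bil] bilinear_radd[OF br_bil] bilinear_lmul[OF br_bil]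
  bilinear_rmul[OF br_bil] bilinear_lneg[OF br_bil] bilinear_rneg[OF br_bil]
  bilinear_lsub[OF br_bil] bilinear_rsub[OF br_bil] bilinear_lzero[OF br_bil] bilinear_rzero[OF br_bil]
lemmas g_simps = bilinear_ladd[OF g_bil] bilinear_radd[OF g_bil] bilinear_lmul[OF g_bil]
  bilinear_rmul[OF g_bil] bilinear_lneg[OF g_bil] bilinear_rneg[OF g_bil]
  bilinear_lsub[OF g_bil] bilinear_rsub[OF g_bil] bilinear_lzero[OF g_bil] bilinear_rzero[OF g_bil]

lemma br_skew: "br y x = - br x y"
  by (rule lie_algebra_skew[OF lie]) auto

lemma g_linear: "linear (g x)"
  using g_bil by (simp add: bilinear_def)

lemma koszul:
  assumes H: "three_form H"
  shows "g (bismut br g H x y) z = (g (br x y) z - g (br y z) x + g (br z x) y + H x y z) / 2"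
  unfolding bismut_def
  by (rule sharp[OF metric])
    (auto simp: br_simps g_simps linear_add[OF three_form_linear(1)[OF H]]
      linear_scale[OF three_form_linear(1)[OF H]] algebra_simps add_divide_distrib diff_divide_distrib
      intro!: linearI)

lemma bilinear_bismut:
  assumes H: "three_form H"
  shows "bilinear (bismut br g H)"
  unfolding bilinear_def
  by (intro conjI allI linearI; rule eqI)
    (simp_all add: koszul[OF H] br_simps g_simps
      linear_add[OF three_form_linear(2)[OF H]] linear_scale[OF three_form_linear(2)[OF H]]
      linear_add[OF three_form_linear(3)[OF H]] linear_scale[OF three_form_linear(3)[OF H]]
      field_simps)

lemma levi_civita_bismut: "levi_civita br g (bismut br g (\<lambda>x y z. 0))"
  unfolding levi_civita_def
proof (intro conjI allI)
  note K = koszul[OF three_form_zero]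
  show "bismut br g (\<lambda>x y z. 0) x y - bismut br g (\<lambda>x y z. 0) y x = br x y" for x y
  proof (rule eqI)
    show "g (bismut br g (\<lambda>x y z. 0) x y - bismut br g (\<lambda>x y z. 0) y x) z = g (br x y) z" for z
      using br_skew[of x y] br_skew[of y z] br_skew[of x z] by (simp add: g_simps K field_simps)
  qed
  show "g (bismut br g (\<lambda>x y z. 0) x y) z + g y (bismut br g (\<lambda>x y z. 0) x z) = 0" for x y z
    unfolding g_sym[of y] K using br_skew[of x y] br_skew[of y z] br_skew[of x z]
    by (simp add: g_simps field_simps)
qed (rule bilinear_bismut[OF three_form_zero])

section \<open>The splitting of \<open>E\<close> into \<open>E_plus\<close> and
  \<open>E_minus\<close>\<close>

lemma Blinfun_g: "blinfun_apply (Blinfun (g x)) y = g x y"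
  using g_linear[of x] by (simp add: bounded_linear_Blinfun_apply linear_conv_bounded_linear)

definition eplus :: "'a \<Rightarrow> 'a gen" where "eplus x = (x, Blinfun (g x))"
definition eminus :: "'a \<Rightarrow> 'a gen" where "eminus x = (x, - Blinfun (g x))"

lemma E_plus_eq: "E_plus g = range eplus" and E_minus_eq: "E_minus g = range eminus"
  by (simp_all add: E_plus_def E_minus_def eplus_def[abs_def] eminus_def[abs_def])

lemma Blinfun_g_linear:
  "Blinfun (g (x + y)) = Blinfun (g x) + Blinfun (g y)" "Blinfun (g (c *\<^sub>R x)) = c *\<^sub>R Blinfun (g x)"
  by (rule blinfun_eqI; simp add: Blinfun_g blinfun.bilinear_simps g_simps)+

lemma linear_plus: "linear eplus" and linear_minus: "linear eminus"
  by (auto simp: eplus_def eminus_def Blinfun_g_linear intro!: linearI)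

lemma pairing_plus_minus: "pairing (eplus x) (eminus y) = 0" "pairing (eminus x) (eplus y) = 0"
  by (simp_all add: pairing_def eplus_def eminus_def Blinfun_g blinfun.bilinear_simps g_sym)

lemma fst_plus [simp]: "fst (eplus x) = x" and fst_minus [simp]: "fst (eminus x) = x"
  by (simp_all add: eplus_def eminus_def)

lemma split_plus_minus:
  obtains x y where "u = eplus x + eminus y"
proof -
  define s where "s = sharp g (blinfun_apply (snd u))"
  have s: "Blinfun (g s) = snd u"
    by (rule blinfun_eqI)
      (simp add: Blinfun_g s_def sharp[OF metric] bounded_linear.linear[OF blinfun.bounded_linear_right])
  have *: "Blinfun (g (x - y)) = Blinfun (g x) - Blinfun (g y)" for x y
    by (rule blinfun_eqI) (simp add: Blinfun_g blinfun.bilinear_simps g_simps)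
  have "u = eplus ((1/2) *\<^sub>R (fst u + s)) + eminus ((1/2) *\<^sub>R (fst u - s))"
    by (simp add: prod_eq_iff eplus_def eminus_def Blinfun_g_linear * s algebra_simps
        flip: scaleR_left_distrib)
  then show ?thesis by (rule that)
qed

section \<open>Mixed parts and Ricci curvature of a Levi-Civita generalized connection\<close>

context
  fixes H D
  assumes H: "three_form H" and D: "gen_levi_civita br H g D"
begin

lemma D_bil: "bilinear D"
  using D by (simp add: gen_levi_civita_def gen_connection_def)

lemmas D_simps = bilinear_ladd[OF D_bil] bilinear_radd[OF D_bil] bilinear_lmul[OF D_bil]
  bilinear_rmul[OF D_bil] bilinear_lneg[OF D_bil] bilinear_rneg[OF D_bil]
  bilinear_lsub[OF D_bil] bilinear_rsub[OF D_bil] bilinear_lzero[OF D_bil] bilinear_rzero[OF D_bil]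

lemma D_plus: "D u (eplus x) \<in> range eplus" and D_minus: "D u (eminus x) \<in> range eminus"
  using D unfolding gen_levi_civita_def E_plus_eq E_minus_eq by blast+

text \<open>\<open>E_plus\<close> and \<open>E_minus\<close> are orthogonal and \<open>D\<close>
  preserves both, so the adjoint term of the torsion vanishes on vectors of opposite type.\<close>

lemma torsion_mixed:
  shows "D (eminus x) (eplus y) - D (eplus y) (eminus x) = dorfman br H (eminus x) (eplus y)"
    and "D (eplus y) (eminus x) - D (eminus x) (eplus y) = dorfman br H (eplus y) (eminus x)"
proof -
  have "pairing (eplus y) (D w (eminus x)) = 0" "pairing (eminus x) (D w (eplus y)) = 0" for w
    using D_plus[of w y] D_minus[of w x] by (auto simp: pairing_plus_minus)
  then have "pairing_adjoint (\<lambda>w. D w (eminus x)) (eplus y) = 0"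
    "pairing_adjoint (\<lambda>w. D w (eplus y)) (eminus x) = 0"
    by (simp_all add: pairing_adjoint_zero)
  moreover have "gen_torsion br H D (eminus x) (eplus y) = 0" "gen_torsion br H D (eplus y) (eminus x) = 0"
    using D unfolding gen_levi_civita_def by blast+
  ultimately show "D (eminus x) (eplus y) - D (eplus y) (eminus x) = dorfman br H (eminus x) (eplus y)"
    and "D (eplus y) (eminus x) - D (eminus x) (eplus y) = dorfman br H (eplus y) (eminus x)"
    by (simp_all add: gen_torsion_def)
qed

text \<open>Vanishing mixed torsion is one equation for two unknowns \<open>a\<close> and
  \<open>b\<close>, but it has two components: the vector part gives \<open>a - b\<close> and the
  covector part gives \<open>g a + g b\<close>. Half the sum and half the difference are Koszul
  formulas with torsion \<open>H\<close> and \<open>- H\<close>.\<close>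

lemma D_mixed:
  shows "D (eminus x) (eplus y) = eplus (bismut br g H x y)"
    and "D (eplus y) (eminus x) = eminus (bismut br g (\<lambda>x y z. - H x y z) y x)"
proof -
  obtain a where a: "D (eminus x) (eplus y) = eplus a" using D_plus by blast
  obtain b where b: "D (eplus y) (eminus x) = eminus b" using D_minus by blast
  have lin: "blinfun_apply (Blinfun f) z = f z" if "linear f" for f :: "'a \<Rightarrow> real" and z
    using that by (simp add: bounded_linear_Blinfun_apply linear_conv_bounded_linear)
  have br_lin: "linear (br w)" for w using br_bil by (simp add: bilinear_def)
  have coad: "blinfun_apply (coad br w \<eta>) z = blinfun_apply \<eta> (br w z)" for w \<eta> z
    unfolding coad_def
    by (rule lin) (simp add: linearI br_simps blinfun.bilinear_simps)
  have eq: "eplus a - eminus b = dorfman br H (eminus x) (eplus y)"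
    using torsion_mixed(1)[of x y] by (simp add: a b)
  have 1: "a - b = br x y" using arg_cong[OF eq, of fst] by (simp add: dorfman_def)
  have 2: "g a z + g b z = - g y (br x z) - g x (br y z) + H x y z" for z
    using arg_cong[OF eq, of "\<lambda>u. blinfun_apply (snd u) z"]
    by (simp add: dorfman_def eplus_def eminus_def Blinfun_g blinfun.bilinear_simps coad
        lin[OF three_form_linear(1)[OF H]])
  have "a = bismut br g H x y"
  proof (rule eqI)
    fix z
    have "2 * g a z = g (a - b) z + (g a z + g b z)" by (simp add: g_simps)
    then show "g a z = g (bismut br g H x y) z"
      unfolding koszul[OF H] 1 2 using br_skew[of x z] by (simp add: g_simps g_sym field_simps)
  qed
  then show "D (eminus x) (eplus y) = eplus (bismut br g H x y)" by (simp add: a)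
  have "b = bismut br g (\<lambda>x y z. - H x y z) y x"
  proof (rule eqI)
    fix z
    have "2 * g b z = (g a z + g b z) - g (a - b) z" by (simp add: g_simps)
    then show "g b z = g (bismut br g (\<lambda>x y z. - H x y z) y x) z"
      unfolding koszul[OF three_form_uminus[OF H]] 1 2
      using br_skew[of x z] br_skew[of x y] br_skew[of y z] three_form_skew(1)[OF H, of x y z]
      by (simp add: g_simps g_sym field_simps)
  qed
  then show "D (eplus y) (eminus x) = eminus (bismut br g (\<lambda>x y z. - H x y z) y x)" by (simp add: b)
qed

text \<open>Only the mixed brackets survive in the Ricci curvature: the components of \<open>D\<close> that are not
  determined by the torsion enter through the divergence and through the trace of a commutator.\<close>

lemma Ric_plus_eq:
  assumes div: "\<And>v. gen_divergence D v = 0"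
  shows "Ric_plus br H g D (eminus u) (eplus v) =
    - endo_trace UNIV (\<lambda>w. bismut br g H (bismut br g (\<lambda>x y z. - H x y z) w u) v)"
proof -
  let ?P = "bismut br g H" and ?M = "bismut br g (\<lambda>x y z. - H x y z)"
  define A where "A = (\<lambda>x y. fst (D (eplus x) (eplus y)))"
  have A: "D (eplus x) (eplus y) = eplus (A x y)" for x y
    using D_plus[of "eplus x" y] by (auto simp: A_def)
  note Pb = bilinear_bismut[OF H] and Mb = bilinear_bismut[OF three_form_uminus[OF H]]
  have Ab: "bilinear A"
    by (auto simp: bilinear_def A_def D_simps linear_add[OF linear_plus] linear_scale[OF linear_plus]
        intro!: linearI)
  have lin: "linear (\<lambda>x. B x y)" "linear (B x)" if "bilinear B" for B :: "'a \<Rightarrow> 'a \<Rightarrow> 'a" and x y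
    using that by (simp_all add: bilinear_def)
  define F where "F w = A w (?P u v) - ?P u (A w v) + A (?P u w) v - ?P (?M w u) v" for w
  \<comment> \<open>The bracket of \<open>eplus w\<close> and \<open>eminus u\<close> is a
    difference of two mixed derivatives, which produces the last two terms of \<open>F\<close>;
    \<open>A\<close> is the part of \<open>D\<close> left free by the mixed torsion.\<close>
  have curv: "curvature (dorfman br H) D (eplus w) (eminus u) (eplus v) = eplus (F w)" for w
    by (simp add: curvature_def F_def torsion_mixed(2)[symmetric] D_mixed A D_simps
        linear_add[OF linear_plus] linear_diff[OF linear_plus])
  have Flin: "linear F"
    unfolding F_def[abs_def]
    by (intro linear_compose_add linear_compose_sub lin[OF Ab]
        linear_compose[OF lin(2)[OF Pb] lin(1)[OF Ab], unfolded o_def]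
        linear_compose[OF lin(1)[OF Ab] lin(2)[OF Pb], unfolded o_def]
        linear_compose[OF lin(1)[OF Mb] lin(1)[OF Pb], unfolded o_def])
  have "Ric_plus br H g D (eminus u) (eplus v) = (\<Sum>b\<in>Basis. fst (eplus (F b)) \<bullet> b)"
    unfolding Ric_plus_def curv[symmetric]
  proof (rule endo_trace_eq[where \<phi>="\<lambda>b x. fst x \<bullet> b"])
    show "span (eplus ` Basis) = E_plus g"
      by (simp add: linear_span_image[OF linear_plus] E_plus_eq)
  qed (auto simp: E_plus_eq curv inner_Basis inner_add_left linear_add[OF Flin] linear_scale[OF Flin]
      linear_add[OF linear_plus, symmetric] linear_scale[OF linear_plus, symmetric] intro!: linearI)
  also have "\<dots> = (\<Sum>b\<in>Basis. A b (?P u v) \<bullet> b) - (\<Sum>b\<in>Basis. ?P u (A b v) \<bullet> b)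
      + (\<Sum>b\<in>Basis. A (?P u b) v \<bullet> b) - (\<Sum>b\<in>Basis. ?P (?M b u) v \<bullet> b)"
    by (simp add: F_def inner_simps sum.distrib sum_subtractf)
  \<comment> \<open>This trace is the divergence of \<open>D\<close> at \<open>eplus y\<close>: the
    directions \<open>eminus b\<close> contribute nothing, since \<open>D\<close> maps
    \<open>eplus y\<close> into \<open>E_plus\<close>, whose \<open>E_minus\<close> components
    vanish.\<close>
  also have "(\<Sum>b\<in>Basis. A b y \<bullet> b) = 0" for y
  proof -
    \<comment> \<open>With \<open>\<xi>\<close> raised to a vector \<open>s\<close>, the two
      components of \<open>(X, \<xi>)\<close> are \<open>eplus\<close> of \<open>(X + s) / 2\<close>
      and \<open>eminus\<close> of \<open>(X - s) / 2\<close>; \<open>\<phi>\<close> reads off their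
      coordinates.\<close>
    define \<phi> where "\<phi> = (\<lambda>(s, b::'a) v. ((if s then fst v + sharp g (blinfun_apply (snd v))
      else fst v - sharp g (blinfun_apply (snd v))) \<bullet> b) / 2)"
    define e where "e = (\<lambda>(s, b). if s then eplus b else eminus b)"
    have sh: "g (sharp g (blinfun_apply \<xi>)) z = blinfun_apply \<xi> z" for \<xi> z
      by (simp add: sharp[OF metric] bounded_linear.linear[OF blinfun.bounded_linear_right])
    have sh_lin: "sharp g (blinfun_apply (\<xi> + \<eta>)) = sharp g (blinfun_apply \<xi>) + sharp g (blinfun_apply \<eta>)"
      "sharp g (blinfun_apply (c *\<^sub>R \<xi>)) = c *\<^sub>R sharp g (blinfun_apply \<xi>)" for \<xi> \<eta> c
      by (rule eqI; simp add: sh g_simps blinfun.bilinear_simps)+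
    have sh_g: "sharp g (blinfun_apply (snd (eplus x))) = x"
      "sharp g (blinfun_apply (snd (eminus x))) = - x" for x
      by (rule eqI; simp add: sh g_simps eplus_def eminus_def Blinfun_g blinfun.bilinear_simps)+
    have "gen_divergence D (eplus y) = (\<Sum>i\<in>UNIV \<times> Basis. \<phi> i (D (e i) (eplus y)))"
      unfolding gen_divergence_def
    proof (rule endo_trace_eq)
      have "u \<in> span (e ` (UNIV \<times> Basis))" for u
      proof -
        obtain x y where u: "u = eplus x + eminus y" by (rule split_plus_minus)
        have "eplus x \<in> span (eplus ` Basis)" "eminus y \<in> span (eminus ` Basis)"
          by (simp_all add: linear_span_image linear_plus linear_minus)
        moreover have "eplus ` Basis \<subseteq> e ` (UNIV \<times> Basis)"
          by (rule image_subsetI, rule image_eqI[of _ e "(True, _)"]) (simp_all add: e_def)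
        moreover have "eminus ` Basis \<subseteq> e ` (UNIV \<times> Basis)"
          by (rule image_subsetI, rule image_eqI[of _ e "(False, _)"]) (simp_all add: e_def)
        ultimately show ?thesis unfolding u by (meson span_add span_mono subsetD)
      qed
      then show "span (e ` (UNIV \<times> Basis)) = UNIV" by auto
    qed (auto simp: \<phi>_def e_def sh_g sh_lin inner_simps inner_Basis D_simps algebra_simps
        add_divide_distrib diff_divide_distrib intro!: linearI split: if_splits)
    also have "\<dots> = (\<Sum>s\<in>UNIV. \<Sum>b\<in>Basis. \<phi> (s, b) (D (e (s, b)) (eplus y)))"
      by (simp add: sum.cartesian_product)
    also have "\<dots> = (\<Sum>b\<in>Basis. A b y \<bullet> b)"
      by (simp add: UNIV_bool \<phi>_def e_def A D_mixed sh_g inner_simps)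
    finally show ?thesis using div by simp
  qed
  \<comment> \<open>The endomorphisms \<open>w \<mapsto> A w v\<close> and \<open>?P u\<close> are
    composed in the two possible orders; the traces agree.\<close>
  also have "(\<Sum>b\<in>Basis. A (?P u b) v \<bullet> b) = (\<Sum>b\<in>Basis. ?P u (A b v) \<bullet> b)"
  proof -
    have tr: "(\<Sum>b\<in>Basis. S (T b) \<bullet> b) = (\<Sum>b\<in>Basis. \<Sum>c\<in>Basis. (T b \<bullet> c) * (S c \<bullet> b))"
      if "linear S" for S T :: "'a \<Rightarrow> 'a"
    proof (rule sum.cong)
      fix b :: 'a
      have "S (T b) = (\<Sum>c\<in>Basis. (T b \<bullet> c) *\<^sub>R S c)"
        using arg_cong[OF euclidean_representation[of "T b"], of S, symmetric] that
        by (simp add: linear_sum linear_scale)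
      then show "S (T b) \<bullet> b = (\<Sum>c\<in>Basis. (T b \<bullet> c) * (S c \<bullet> b))"
        by (simp add: inner_sum_left)
    qed simp
    show ?thesis
      unfolding tr[OF lin(1)[OF Ab]] tr[OF lin(2)[OF Pb]]
      by (subst sum.swap) (simp add: mult.commute)
  qed
  finally show ?thesis
    by (subst endo_trace_UNIV)
      (simp_all add: linear_compose[OF lin(1)[OF Mb] lin(1)[OF Pb], unfolded o_def])
qed

end

lemma gen_einstein_imp_trace:
  assumes "gen_einstein br H g 0"
  shows "endo_trace UNIV (\<lambda>w. bismut br g H (bismut br g (\<lambda>x y z. - H x y z) w u) v) = 0"
proof -
  obtain D where H: "three_form H" and D: "gen_levi_civita br H g D"
    and "\<And>v. gen_divergence D v = 0"
    and "Ric_plus br H g D (eminus u) (eplus v) = 0"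
    using assms by (auto simp: gen_einstein_def E_plus_eq E_minus_eq)
  then show ?thesis using Ric_plus_eq[OF H D] by simp
qed

end

section \<open>Unimodular Lie algebras with a pseudo-Riemannian metric\<close>

text \<open>The signs stay symbolic, so that one set of computations covers every signature.\<close>

locale unimodular_frame = metric_lie_algebra br g
  for br :: "'a::euclidean_space \<Rightarrow> 'a \<Rightarrow> 'a" and g +
  fixes u1 u2 u3 :: 'a and s1 s2 s3 :: real
  assumes unimod: "unimodular UNIV br"
    and frame_span: "span {u1, u2, u3} = UNIV"
    and frame_orth: "g u1 u2 = 0" "g u2 u3 = 0" "g u3 u1 = 0"
    and frame_norm: "g u1 u1 = s1" "g u2 u2 = s2" "g u3 u3 = s3"
    and signs: "s1 = 1 \<or> s1 = - 1" "s2 = 1 \<or> s2 = - 1" "s3 = 1 \<or> s3 = - 1"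
begin

section \<open>Pseudo-orthonormal frames and the cross product\<close>

lemma frame_gram [simp]: "g u1 u1 = s1" "g u2 u2 = s2" "g u3 u3 = s3" "g u1 u2 = 0" "g u2 u3 = 0"
  "g u3 u1 = 0" "g u2 u1 = 0" "g u3 u2 = 0" "g u1 u3 = 0"
  using frame_orth frame_norm g_sym[of u1 u2] g_sym[of u2 u3] g_sym[of u1 u3] by simp_all

lemma sign_square [simp]: "s1 * s1 = 1" "s2 * s2 = 1" "s3 * s3 = 1"
  "s1 * (s1 * a) = a" "s2 * (s2 * a) = a" "s3 * (s3 * a) = a"
  using signs by auto

lemma frame_expand: "x = (s1 * g x u1) *\<^sub>R u1 + (s2 * g x u2) *\<^sub>R u2 + (s3 * g x u3) *\<^sub>R u3"
proof -
  have "linear (\<lambda>x. (s1 * g x u1) *\<^sub>R u1 + (s2 * g x u2) *\<^sub>R u2 + (s3 * g x u3) *\<^sub>R u3)"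
    by (auto simp: g_simps algebra_simps intro!: linearI)
  then show ?thesis
    by (rule linear_eq_on_span[OF linear_ident, of _ "{u1, u2, u3}"]) (auto simp: frame_span)
qed

lemma frame_eqI: "g x u1 = g y u1 \<Longrightarrow> g x u2 = g y u2 \<Longrightarrow> g x u3 = g y u3 \<Longrightarrow> x = y"
  using frame_expand[of x] frame_expand[of y] by simp

lemma frame_g: "g x y = s1 * g x u1 * g y u1 + s2 * g x u2 * g y u2 + s3 * g x u3 * g y u3"
proof -
  have "g x y = g x ((s1 * g y u1) *\<^sub>R u1 + (s2 * g y u2) *\<^sub>R u2 + (s3 * g y u3) *\<^sub>R u3)"
    using frame_expand[of y] by simp
  then show ?thesis by (simp only: g_simps) (simp add: mult_ac)
qed

lemma frame_trace:
  assumes f: "linear f"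
  shows "endo_trace UNIV f = s1 * g (f u1) u1 + s2 * g (f u2) u2 + s3 * g (f u3) u3"
  by (rule endo_trace_basis3[OF frame_span])
    (auto simp: linear_add[OF f] linear_scale[OF f] g_simps algebra_simps intro!: linearI)

text \<open>The product with \<open>g (cross x y) z = vol x y z\<close>, where \<open>vol\<close> is
  the volume form normalised by \<open>vol u1 u2 u3 = 1\<close>; the prefactor
  \<open>s1 * s2 * s3\<close> achieves this normalisation.\<close>

definition cross :: "'a \<Rightarrow> 'a \<Rightarrow> 'a" where
  "cross x y = (s1 * s2 * s3) *\<^sub>R
     ((g x u2 * g y u3 - g x u3 * g y u2) *\<^sub>R u1 + (g x u3 * g y u1 - g x u1 * g y u3) *\<^sub>R u2
      + (g x u1 * g y u2 - g x u2 * g y u1) *\<^sub>R u3)"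

lemma g_cross [simp]:
  "g (cross x y) u1 = s2 * s3 * (g x u2 * g y u3 - g x u3 * g y u2)"
  "g (cross x y) u2 = s3 * s1 * (g x u3 * g y u1 - g x u1 * g y u3)"
  "g (cross x y) u3 = s1 * s2 * (g x u1 * g y u2 - g x u2 * g y u1)"
  by (simp_all add: cross_def g_simps mult_ac)

lemma bilinear_cross: "bilinear cross"
  by (auto simp: bilinear_def intro!: linearI frame_eqI) (simp_all add: g_simps algebra_simps)

lemmas cross_simps = bilinear_ladd[OF bilinear_cross] bilinear_radd[OF bilinear_cross]
  bilinear_lmul[OF bilinear_cross] bilinear_rmul[OF bilinear_cross]
  bilinear_lneg[OF bilinear_cross] bilinear_rneg[OF bilinear_cross]
  bilinear_lsub[OF bilinear_cross] bilinear_rsub[OF bilinear_cross]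
  bilinear_lzero[OF bilinear_cross] bilinear_rzero[OF bilinear_cross]

lemma cross_refl [simp]: "cross x x = 0"
  by (rule frame_eqI) (simp_all add: g_simps)

lemma cross_skew: "cross y x = - cross x y"
  by (rule frame_eqI) (simp_all add: g_simps algebra_simps)

lemma cross_jacobi: "cross x (cross y z) - cross y (cross x z) = cross (cross x y) z"
  by (rule frame_eqI) (simp_all add: g_simps algebra_simps)

text \<open>The signature enters only through \<open>s1 * s2 * s3\<close>, the determinant of the
  Gram matrix of the frame.\<close>

lemma cross_cross: "cross (cross x y) z = (s1 * s2 * s3) *\<^sub>R (g x z *\<^sub>R y - g y z *\<^sub>R x)"
  by (rule frame_eqI) (simp_all add: frame_g[of x z] frame_g[of y z] g_simps algebra_simps)

lemma triple_cyclic: "g (cross x y) z = g (cross y z) x"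
  unfolding frame_g[of _ z] frame_g[of _ x] by (simp add: algebra_simps)

lemma triple_zero [simp]: "g (cross x y) x = 0" "g (cross x y) y = 0"
proof -
  show "g (cross x y) x = 0" unfolding frame_g[of _ x] by (simp add: algebra_simps)
  show "g (cross x y) y = 0" unfolding frame_g[of _ y] by (simp add: algebra_simps)
qed

lemma g_cross_cross:
  "g (cross x y) (cross x y) = s1 * s2 * s3 * (g x x * g y y - g x y * g x y)"
proof -
  have "g (cross x y) (cross x y) = g (cross (cross x y) x) y" by (simp add: triple_cyclic)
  then show ?thesis by (simp add: cross_cross g_simps g_sym[of y x] algebra_simps)
qed

section \<open>The endomorphisms encoding the bracket and the connection\<close>

definition L :: "'a \<Rightarrow> 'a" where
  "L x = g x u1 *\<^sub>R br u2 u3 + g x u2 *\<^sub>R br u3 u1 + g x u3 *\<^sub>R br u1 u2"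

lemma linear_L: "linear L"
  by (auto simp: L_def g_simps algebra_simps intro!: linearI)

text \<open>In dimension three the cross product identifies bivectors with vectors, so every skew
  bracket factors through it. As \<open>u2 \<times> u3 = s1 u1\<close>, the factor must send
  \<open>u1\<close> to \<open>s1\<close> times the bracket of \<open>u2\<close> and
  \<open>u3\<close>, which the coefficient \<open>g x u1\<close> in \<open>L\<close>
  achieves.\<close>

lemma br_eq: "br x y = L (cross x y)"
proof -
  have "br x x = 0" for x using lie by (simp add: lie_algebra_def)
  moreover have "br x y = br ((s1 * g x u1) *\<^sub>R u1 + (s2 * g x u2) *\<^sub>R u2 + (s3 * g x u3) *\<^sub>R u3)
      ((s1 * g y u1) *\<^sub>R u1 + (s2 * g y u2) *\<^sub>R u2 + (s3 * g y u3) *\<^sub>R u3)"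
    using frame_expand[of x] frame_expand[of y] by simp
  ultimately show ?thesis
    using br_skew[of u1 u2] br_skew[of u2 u3] br_skew[of u3 u1]
    by (simp only: br_simps) (simp add: L_def algebra_simps)
qed

lemma L_frame: "L u1 = s1 *\<^sub>R br u2 u3" "L u2 = s2 *\<^sub>R br u3 u1" "L u3 = s3 *\<^sub>R br u1 u2"
  by (simp_all add: L_def)

text \<open>Unimodularity removes the skew part of \<open>L\<close>: in the trace of
  \<open>br u3\<close> the \<open>u3\<close> entry drops out, and the other two are
  \<open>g (L u2) u1\<close> and \<open>- g (L u1) u2\<close> with the common factor
  \<open>s1 * s2\<close>; the other two equations arise likewise from \<open>u1\<close> and
  \<open>u2\<close>.\<close>

lemma L_self_adjoint_frame: "g (L u1) u2 = g (L u2) u1" "g (L u2) u3 = g (L u3) u2" "g (L u3) u1 = g (L u1) u3"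
proof -
  have tr: "s1 * g (br x u1) u1 + s2 * g (br x u2) u2 + s3 * g (br x u3) u3 = 0" for x
    using unimod frame_trace[of "br x"] br_bil by (simp add: unimodular_def bilinear_def)
  have 0: "br x x = 0" for x using lie by (simp add: lie_algebra_def)
  show "g (L u1) u2 = g (L u2) u1" using tr[of u3] br_skew[of u2 u3] signs
    by (auto simp: L_frame 0 g_simps)
  show "g (L u2) u3 = g (L u3) u2" using tr[of u1] br_skew[of u3 u1] signs
    by (auto simp: L_frame 0 g_simps)
  show "g (L u3) u1 = g (L u1) u3" using tr[of u2] br_skew[of u1 u2] signs
    by (auto simp: L_frame 0 g_simps)
qed

lemma linear_frame:
  assumes "linear f"
  shows "f x = (s1 * g x u1) *\<^sub>R f u1 + (s2 * g x u2) *\<^sub>R f u2 + (s3 * g x u3) *\<^sub>R f u3"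
  using arg_cong[OF frame_expand[of x], of f]
  by (simp only: linear_add[OF assms] linear_scale[OF assms])

lemma L_self_adjoint: "g (L x) y = g x (L y)"
proof -
  have "g (L x) y = g (L y) x"
    using L_self_adjoint_frame
    unfolding frame_g[of _ y] frame_g[of _ x] linear_frame[OF linear_L, of x] linear_frame[OF linear_L, of y] g_simps
    by (simp add: algebra_simps)
  then show ?thesis by (simp add: g_sym)
qed

text \<open>The endomorphism for which the Levi-Civita connection is \<open>x, y \<mapsto> M x \<times> y\<close>.\<close>

definition M :: "'a \<Rightarrow> 'a" where
  "M x = ((s1 * g (L u1) u1 + s2 * g (L u2) u2 + s3 * g (L u3) u3) / 2) *\<^sub>R x - L x"

lemma linear_M: "linear M"
  by (auto simp: M_def linear_add[OF linear_L] linear_scale[OF linear_L] algebra_simps intro!: linearI)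

text \<open>In dimension three \<open>M = tr L / 2 - L\<close> has trace
  \<open>3/2 tr L - tr L = tr L / 2\<close>, so the relation inverts to
  \<open>L = tr M - M\<close>.\<close>

lemma L_eq: "L x = (s1 * g (M u1) u1 + s2 * g (M u2) u2 + s3 * g (M u3) u3) *\<^sub>R x - M x"
proof -
  have "s1 * g (M u1) u1 + s2 * g (M u2) u2 + s3 * g (M u3) u3 =
      (s1 * g (L u1) u1 + s2 * g (L u2) u2 + s3 * g (L u3) u3) / 2"
    by (simp add: M_def g_simps field_simps)
  then show ?thesis by (simp add: M_def)
qed

lemma M_self_adjoint: "g (M x) y = g x (M y)"
  by (simp add: M_def g_simps L_self_adjoint)

lemma M_frame_sym: "g (M u2) u1 = g (M u1) u2" "g (M u3) u2 = g (M u2) u3" "g (M u3) u1 = g (M u1) u3"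
  by (metis M_self_adjoint g_sym)+

section \<open>The Einstein equation as an equation for \<open>M\<close>\<close>

lemma three_form_eq:
  assumes H: "three_form H"
  shows "H x y z = H u1 u2 u3 * g (cross x y) z"
proof -
  have fr: "f x = s1 * g x u1 * f u1 + s2 * g x u2 * f u2 + s3 * g x u3 * f u3"
    if "linear f" for f :: "'a \<Rightarrow> real" and x
    using arg_cong[OF frame_expand[of x], of f] that
    by (simp add: linear_add linear_scale)
  have Z: "H u v z = s1 * g z u1 * H u v u1 + s2 * g z u2 * H u v u2 + s3 * g z u3 * H u v u3" for u v
    by (rule fr[OF three_form_linear(1)[OF H]])
  have Y: "H u y w = s1 * g y u1 * H u u1 w + s2 * g y u2 * H u u2 w + s3 * g y u3 * H u u3 w" for u w
    by (rule fr[OF three_form_linear(2)[OF H]])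
  have X: "H x v w = s1 * g x u1 * H u1 v w + s2 * g x u2 * H u2 v w + s3 * g x u3 * H u3 v w" for v w
    by (rule fr[OF three_form_linear(3)[OF H]])
  show ?thesis
    unfolding Z Y X frame_g[of _ z]
    using three_form_skew(1)[OF H, of u1 u2 u3] three_form_skew(2)[OF H, of u1 u2 u3]
      three_form_skew(2)[OF H, of u2 u1 u3] three_form_skew(1)[OF H, of u1 u3 u2]
      three_form_skew(1)[OF H, of u2 u3 u1]
    by (simp add: three_form_skew(3-5)[OF H] algebra_simps)
qed

lemma bismut_eq:
  assumes H: "three_form H"
  shows "bismut br g H x y = cross (M x + (H u1 u2 u3 / 2) *\<^sub>R x) y"
proof (rule eqI)
  fix z
  have "g (bismut br g H x y) z = (g (cross x y) (L z) - g (cross y z) (L x) + g (cross z x) (L y)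
      + H u1 u2 u3 * g (cross x y) z) / 2"
    by (simp only: koszul[OF H] br_eq L_self_adjoint three_form_eq[OF H, of x y z])
  also have "g (cross x y) (L z) - g (cross y z) (L x) + g (cross z x) (L y) = 2 * g (cross (M x) y) z"
  proof -
    have 1: "g (cross y z) (M x) = g (cross (M x) y) z" by (simp add: triple_cyclic)
    \<comment> \<open>An endomorphism acts on the volume form as a derivation by multiplication with
      its trace. Substituting \<open>L = tr M - M\<close>, the alternating sum equals
      \<open>tr M\<close> times the volume, minus this cyclic sum, plus twice the middle
      term.\<close>
    have "g (cross x y) (M z) + g (cross y z) (M x) + g (cross z x) (M y)
       = (s1 * g (M u1) u1 + s2 * g (M u2) u2 + s3 * g (M u3) u3) * g (cross x y) z"
      unfolding frame_g[of _ z] frame_g[of _ "M x"] frame_g[of _ "M y"] frame_g[of _ "M z"]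
        linear_frame[OF linear_M, of x] linear_frame[OF linear_M, of y] linear_frame[OF linear_M, of z]
        g_simps frame_g[of _ "M u1"] frame_g[of _ "M u2"] frame_g[of _ "M u3"]
      by (simp add: M_frame_sym algebra_simps)
    moreover have "g (cross y z) x = g (cross x y) z" "g (cross z x) y = g (cross x y) z"
      by (metis triple_cyclic)+
    ultimately show ?thesis using 1 by (simp add: L_eq g_simps algebra_simps)
  qed
  finally show "g (bismut br g H x y) z = g (cross (M x + (H u1 u2 u3 / 2) *\<^sub>R x) y) z"
    by (simp add: cross_simps g_simps field_simps)
qed

text \<open>The condition \<open>adj M = (h/2)\<^sup>2 I\<close>, with the index of \<open>M\<close> lowered by \<open>g\<close>.\<close>

lemma einstein_minors:
  assumes einstein: "gen_einstein br H g 0"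
  defines "m \<equiv> \<lambda>x y. g (M x) y" and "k \<equiv> (H u1 u2 u3 / 2)\<^sup>2"
  shows "m u2 u2 * m u3 u3 - m u2 u3 * m u2 u3 = s2 * s3 * k"
    and "m u3 u3 * m u1 u1 - m u1 u3 * m u1 u3 = s3 * s1 * k"
    and "m u1 u1 * m u2 u2 - m u1 u2 * m u1 u2 = s1 * s2 * k"
    and "m u1 u2 * m u3 u3 = m u1 u3 * m u2 u3"
    and "m u2 u3 * m u1 u1 = m u1 u2 * m u1 u3"
    and "m u1 u3 * m u2 u2 = m u1 u2 * m u2 u3"
proof -
  let ?h = "H u1 u2 u3 / 2"
  have H: "three_form H" using einstein by (simp add: gen_einstein_def)
  have "endo_trace UNIV (\<lambda>w. cross (M (cross (M w - ?h *\<^sub>R w) u) + ?h *\<^sub>R cross (M w - ?h *\<^sub>R w) u) v) = 0"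
    for u v
    using gen_einstein_imp_trace[OF einstein, of u v]
    by (simp add: bismut_eq[OF H] bismut_eq[OF three_form_uminus[OF H]])
  moreover have "linear (\<lambda>w. cross (M (cross (M w - ?h *\<^sub>R w) u) + ?h *\<^sub>R cross (M w - ?h *\<^sub>R w) u) v)"
    for u v
    by (auto simp: cross_simps linear_add[OF linear_M] linear_scale[OF linear_M] linear_diff[OF linear_M]
        algebra_simps intro!: linearI)
  ultimately have tr: "s1 * g (cross (M (cross (M u1 - ?h *\<^sub>R u1) u) + ?h *\<^sub>R cross (M u1 - ?h *\<^sub>R u1) u) v) u1
    + s2 * g (cross (M (cross (M u2 - ?h *\<^sub>R u2) u) + ?h *\<^sub>R cross (M u2 - ?h *\<^sub>R u2) u) v) u2
    + s3 * g (cross (M (cross (M u3 - ?h *\<^sub>R u3) u) + ?h *\<^sub>R cross (M u3 - ?h *\<^sub>R u3) u) v) u3 = 0" for u v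
    by (simp only: frame_trace)
  note expand = linear_frame[OF linear_M, of "cross _ _"] M_frame_sym m_def k_def
    g_simps power2_eq_square
  \<comment> \<open>Equal arguments \<open>u\<close> and \<open>v\<close> give the diagonal
    cofactors, distinct frame vectors the off-diagonal ones; the symmetry of \<open>M\<close>
    cancels the terms linear in \<open>h\<close>.\<close>
  show "m u2 u2 * m u3 u3 - m u2 u3 * m u2 u3 = s2 * s3 * k"
    using tr[of u1 u1] signs by (auto simp: expand algebra_simps)
  show "m u3 u3 * m u1 u1 - m u1 u3 * m u1 u3 = s3 * s1 * k"
    using tr[of u2 u2] signs by (auto simp: expand algebra_simps)
  show "m u1 u1 * m u2 u2 - m u1 u2 * m u1 u2 = s1 * s2 * k"
    using tr[of u3 u3] signs by (auto simp: expand algebra_simps)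
  show "m u1 u2 * m u3 u3 = m u1 u3 * m u2 u3"
    using tr[of u1 u2] signs by (auto simp: expand algebra_simps)
  show "m u2 u3 * m u1 u1 = m u1 u2 * m u1 u3"
    using tr[of u2 u3] signs by (auto simp: expand algebra_simps)
  show "m u1 u3 * m u2 u2 = m u1 u2 * m u2 u3"
    using tr[of u1 u3] signs by (auto simp: expand algebra_simps)
qed

text \<open>In matrix terms, \<open>M (adj M) = det M\<close> together with
  \<open>adj M = k\<close>, \<open>k \<noteq> 0\<close>, forces
  \<open>M = det M / k\<close>.\<close>

lemma einstein_scalar:
  assumes einstein: "gen_einstein br H g 0" and h: "H u1 u2 u3 \<noteq> 0"
  obtains c where "c \<noteq> 0" "\<And>x. M x = c *\<^sub>R x"
proof -
  define k where "k = (H u1 u2 u3 / 2)\<^sup>2"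
  note E = einstein_minors[OF einstein, folded k_def]
  have k: "k \<noteq> 0" using h by (simp add: k_def)
  have s: "s1 \<noteq> 0" "s2 \<noteq> 0" "s3 \<noteq> 0" using signs by auto
  define p where "p = g (M u1) u1"
  define q where "q = g (M u2) u2"
  define r where "r = g (M u3) u3"
  define u where "u = g (M u1) u2"
  define v where "v = g (M u2) u3"
  define w where "w = g (M u1) u3"
  note F = E[folded p_def q_def r_def u_def v_def w_def]
  \<comment> \<open>An off-diagonal entry times a diagonal cofactor: the off-diagonal equations give
    \<open>u r p = w v p = u w w\<close>, so \<open>u (r p - w w) = 0\<close>. The entries
    \<open>v\<close> and \<open>w\<close> are treated alike.\<close>
  have "u * (s3 * s1 * k) = 0" unfolding F(2)[symmetric] using F(4,5) by algebra
  then have u: "u = 0" using k s by simp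
  have "v * (s1 * s2 * k) = 0" unfolding F(3)[symmetric] using F(5,6) by algebra
  then have v: "v = 0" using k s by simp
  have "w * (s2 * s3 * k) = 0" unfolding F(1)[symmetric] using F(4,6) by algebra
  then have w: "w = 0" using k s by simp
  \<comment> \<open>With the off-diagonal entries gone, all of these products equal
    \<open>p q r\<close>.\<close>
  have "p * (s2 * s3 * k) = q * (s3 * s1 * k)" "q * (s3 * s1 * k) = r * (s1 * s2 * k)"
    unfolding F(1-3)[symmetric] u v w by simp_all
  then have "p * s2 * (s3 * k) = q * s1 * (s3 * k)" "q * s3 * (s1 * k) = r * s2 * (s1 * k)"
    by (simp_all add: mult_ac)
  then have pqr: "p * s2 = q * s1" "q * s3 = r * s2"
    using k s by (metis mult_right_cancel no_zero_divisors)+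
  have "M x = (s1 * p) *\<^sub>R x" for x
  proof (rule frame_eqI)
    show "g (M x) u1 = g ((s1 * p) *\<^sub>R x) u1"
      using linear_frame[OF linear_M, of x] u w M_frame_sym
      by (simp add: g_simps p_def u_def w_def)
    show "g (M x) u2 = g ((s1 * p) *\<^sub>R x) u2"
      using linear_frame[OF linear_M, of x] u v M_frame_sym pqr signs
      by (auto simp add: g_simps p_def q_def u_def v_def)
    show "g (M x) u3 = g ((s1 * p) *\<^sub>R x) u3"
      using linear_frame[OF linear_M, of x] v w M_frame_sym pqr signs
      by (auto simp add: g_simps p_def q_def r_def v_def w_def)
  qed
  moreover have "s1 * p \<noteq> 0"
    using F(3) u s k by auto
  ultimately show ?thesis using that by blast
qed

text \<open>All 2 by 2 minors of the symmetric matrix of \<open>M\<close> vanish, so its rank is at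
  most one. A non-zero diagonal entry \<open>g (M v) v\<close> exhibits \<open>M\<close> as the
  square of the covector of \<open>M v\<close> divided by that entry; if the diagonal is zero, the
  minors make the squares of the other entries zero. The scalar \<open>c\<close> stays separate
  because its sign cannot be absorbed into \<open>v\<close> over the reals.\<close>

lemma einstein_rank_one:
  assumes einstein: "gen_einstein br H g 0" and h: "H u1 u2 u3 = 0"
  obtains c v where "\<And>x. M x = (c * g v x) *\<^sub>R v"
proof -
  note result = that
  note E = einstein_minors[OF einstein, unfolded h, simplified]
  have *: thesis if nz: "g (M v) v \<noteq> 0"
    and minors: "\<And>x y. x \<in> {u1, u2, u3} \<Longrightarrow> y \<in> {u1, u2, u3} \<Longrightarrow> g (M x) y * g (M v) v = g (M v) x * g (M v) y" for v
  proof (rule result)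
    fix x
    have "g (M y) z = g ((inverse (g (M v) v) * g (M v) y) *\<^sub>R M v) z" if "y \<in> {u1, u2, u3}" "z \<in> {u1, u2, u3}" for y z
      using minors[OF that] nz by (simp add: g_simps field_simps)
    then have "M y = (inverse (g (M v) v) * g (M v) y) *\<^sub>R M v" if "y \<in> {u1, u2, u3}" for y
      using that by (intro frame_eqI) auto
    then have "M x = (inverse (g (M v) v) *
        (s1 * g x u1 * g (M v) u1 + s2 * g x u2 * g (M v) u2 + s3 * g x u3 * g (M v) u3)) *\<^sub>R M v"
      using linear_frame[OF linear_M, of x] by (simp add: algebra_simps)
    then show "M x = (inverse (g (M v) v) * g (M v) x) *\<^sub>R M v"
      by (simp add: frame_g[of "M v" x] mult_ac)
  qed
  consider "g (M u1) u1 \<noteq> 0" | "g (M u2) u2 \<noteq> 0" | "g (M u3) u3 \<noteq> 0"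
    | "g (M u1) u1 = 0" "g (M u2) u2 = 0" "g (M u3) u3 = 0" by blast
  then show thesis
  proof cases
    case 4
    then have "g (M u1) u2 = 0" "g (M u2) u3 = 0" "g (M u1) u3 = 0" using E by auto
    then have "M x = 0" for x
      using 4 linear_frame[OF linear_M, of x] M_frame_sym
      by (intro frame_eqI) (simp_all add: g_simps)
    then show thesis using that[of 0 0] by simp
  next
    case 1
    then show thesis by (rule *) (use E M_frame_sym in \<open>auto simp: mult_ac\<close>)
  next
    case 2
    then show thesis by (rule *) (use E M_frame_sym in \<open>auto simp: mult_ac\<close>)
  next
    case 3
    then show thesis by (rule *) (use E M_frame_sym in \<open>auto simp: mult_ac\<close>)
  qed
qed

end

section \<open>Milnor bases\<close>

text \<open>Independence is stated through coefficients of the ordered triple, not for the set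
  \<open>{x, y, z}\<close>, so that the three vectors are automatically distinct.\<close>

definition basis3 :: "'v::real_vector set \<Rightarrow> 'v \<Rightarrow> 'v \<Rightarrow> 'v \<Rightarrow> bool" where
  "basis3 V x y z \<longleftrightarrow> span {x, y, z} = V \<and>
     (\<forall>p q r. p *\<^sub>R x + q *\<^sub>R y + r *\<^sub>R z = 0 \<longrightarrow> p = 0 \<and> q = 0 \<and> r = 0)"

lemma span3: "u \<in> span {x, y, z} \<longleftrightarrow> (\<exists>p q r. u = p *\<^sub>R x + q *\<^sub>R y + r *\<^sub>R z)"
proof -
  have "u - p *\<^sub>R x - q *\<^sub>R y = r *\<^sub>R z \<longleftrightarrow> u = p *\<^sub>R x + q *\<^sub>R y + r *\<^sub>R z" for p q r
    by (auto simp: algebra_simps)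
  then show ?thesis by (simp add: span_breakdown_eq span_singleton image_iff)
qed

lemma basis3D:
  assumes "basis3 V x y z"
  shows "x \<in> V" "y \<in> V" "z \<in> V"
  using assms by (auto simp: basis3_def intro: span_base)

lemma basis3_expand:
  assumes "basis3 V x y z" "u \<in> V"
  obtains p q r where "u = p *\<^sub>R x + q *\<^sub>R y + r *\<^sub>R z"
proof -
  have "u \<in> span {x, y, z}" using assms by (simp add: basis3_def)
  then show ?thesis using that unfolding span3 by blast
qed

lemma basis3_zero:
  "basis3 V x y z \<Longrightarrow> p *\<^sub>R x + q *\<^sub>R y + r *\<^sub>R z = 0 \<Longrightarrow> p = 0 \<and> q = 0 \<and> r = 0"
  unfolding basis3_def by blast

lemma basis3_rotate: "basis3 V x y z \<Longrightarrow> basis3 V y z x"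
proof -
  assume b: "basis3 V x y z"
  have "p = 0 \<and> q = 0 \<and> r = 0" if "p *\<^sub>R y + q *\<^sub>R z + r *\<^sub>R x = 0" for p q r
    using basis3_zero[OF b, of r p q] that by (simp add: ac_simps)
  then show ?thesis using b by (simp add: basis3_def insert_commute)
qed

lemma basis3_swap: "basis3 V x y z \<Longrightarrow> basis3 V y x z"
proof -
  assume b: "basis3 V x y z"
  have "p = 0 \<and> q = 0 \<and> r = 0" if "p *\<^sub>R y + q *\<^sub>R x + r *\<^sub>R z = 0" for p q r
    using basis3_zero[OF b, of q p r] that by (simp add: ac_simps)
  then show ?thesis using b by (simp add: basis3_def insert_commute)
qed

lemma basis3_independent:
  assumes "basis3 V x y z"
  shows "independent {x, y, z}" "x \<noteq> y" "y \<noteq> z" "z \<noteq> x"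
proof -
  have ind: "p = 0 \<and> q = 0 \<and> r = 0" if "p *\<^sub>R x + q *\<^sub>R y + r *\<^sub>R z = 0" for p q r
    using assms that by (simp add: basis3_def)
  show d: "x \<noteq> y" "y \<noteq> z" "z \<noteq> x"
    using ind[of 1 "-1" 0] ind[of 0 1 "-1"] ind[of 1 0 "-1"] by auto
  have "z \<noteq> 0" using ind[of 0 0 1] by auto
  moreover have "y \<notin> span {z}"
  proof
    assume "y \<in> span {z}"
    then obtain r where "y = r *\<^sub>R z" by (auto simp: span_singleton)
    then show False using ind[of 0 "-1" r] by simp
  qed
  moreover have "x \<notin> span {y, z}"
  proof
    assume "x \<in> span {y, z}"
    then obtain q r where "x = q *\<^sub>R y + r *\<^sub>R z"
      by (auto simp: span_breakdown_eq span_singleton algebra_simps)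
    then show False using ind[of "-1" q r] by simp
  qed
  ultimately show "independent {x, y, z}"
    using d by (simp add: independent_insert dependent_single)
qed

lemma basis3_dim:
  assumes "basis3 V x y z"
  shows "dim V = 3"
proof -
  have "dim V = card {x, y, z}"
    using dim_eq_card_independent[OF basis3_independent(1)[OF assms]] assms
    by (metis basis3_def dim_span)
  then show ?thesis using basis3_independent[OF assms] by auto
qed

lemma basis3_dual:
  assumes "basis3 V x y z"
  obtains p q r :: "'v::real_vector \<Rightarrow> real" where "linear p" "linear q" "linear r"
    "p x = 1" "p y = 0" "p z = 0" "q x = 0" "q y = 1" "q z = 0" "r x = 0" "r y = 0" "r z = 1"
    "\<And>u. u \<in> V \<Longrightarrow> u = p u *\<^sub>R x + q u *\<^sub>R y + r u *\<^sub>R z"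
proof -
  note ind = basis3_independent[OF assms]
  have "\<exists>f. linear f \<and> (\<forall>u\<in>{x, y, z}. f u = (if u = w then 1 else 0::real))" for w
    by (rule linear_independent_extend[OF ind(1)])
  then obtain f where f: "\<And>w. linear (f w)" "\<And>u w. u \<in> {x, y, z} \<Longrightarrow> f w u = (if u = w then 1 else 0::real)"
    by metis
  show ?thesis
  proof (rule that[of "f x" "f y" "f z"])
    fix u assume "u \<in> V"
    then obtain p q r where "u = p *\<^sub>R x + q *\<^sub>R y + r *\<^sub>R z" by (rule basis3_expand[OF assms])
    then show "u = f x u *\<^sub>R x + f y u *\<^sub>R y + f z u *\<^sub>R z"
      using ind f by (simp add: linear_add linear_scale)
  qed (use f ind in auto)
qed

lemma lie_algebra_expand:
  assumes lie: "lie_algebra V br" and V: "x \<in> V" "y \<in> V" "z \<in> V"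
  shows "br (p *\<^sub>R x + q *\<^sub>R y + r *\<^sub>R z) (p' *\<^sub>R x + q' *\<^sub>R y + r' *\<^sub>R z) =
    (q * r' - r * q') *\<^sub>R br y z + (r * p' - p * r') *\<^sub>R br z x + (p * q' - q * p') *\<^sub>R br x y"
proof -
  have sub: "subspace V" using lie by (simp add: lie_algebra_def)
  note cl = subspace_add[OF sub] subspace_scale[OF sub] V
  have 1: "br (u + v) w = br u w + br v w" "br w (u + v) = br w u + br w v"
    if "u \<in> V" "v \<in> V" "w \<in> V" for u v w
    using lie that unfolding lie_algebra_def by blast+
  have 2: "br (c *\<^sub>R u) w = c *\<^sub>R br u w" "br w (c *\<^sub>R u) = c *\<^sub>R br w u"
    if "u \<in> V" "w \<in> V" for u w c
    using lie that unfolding lie_algebra_def by blast+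
  have 3: "br u u = 0" if "u \<in> V" for u
    using lie that unfolding lie_algebra_def by blast
  show ?thesis
    using lie_algebra_skew[OF lie V(1,2)] lie_algebra_skew[OF lie V(2,3)] lie_algebra_skew[OF lie V(3,1)]
    by (simp add: 1 2 3 cl algebra_simps)
qed

text \<open>Milnor's normal form of the three-dimensional unimodular Lie algebras.\<close>

definition milnor_basis ::
  "'v::real_vector set \<Rightarrow> ('v \<Rightarrow> 'v \<Rightarrow> 'v) \<Rightarrow> real \<Rightarrow> real \<Rightarrow> real \<Rightarrow> 'v \<Rightarrow> 'v \<Rightarrow> 'v \<Rightarrow> bool" where
  "milnor_basis V br a b c x y z \<longleftrightarrow>
     basis3 V x y z \<and> br y z = a *\<^sub>R x \<and> br z x = b *\<^sub>R y \<and> br x y = c *\<^sub>R z"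

definition milnor :: "'v::real_vector set \<Rightarrow> ('v \<Rightarrow> 'v \<Rightarrow> 'v) \<Rightarrow> real \<Rightarrow> real \<Rightarrow> real \<Rightarrow> bool" where
  "milnor V br a b c \<longleftrightarrow> (\<exists>x y z. milnor_basis V br a b c x y z)"

lemma milnor_basis_expand:
  assumes "lie_algebra V br" "milnor_basis V br a b c x y z"
  shows "br (p *\<^sub>R x + q *\<^sub>R y + r *\<^sub>R z) (p' *\<^sub>R x + q' *\<^sub>R y + r' *\<^sub>R z) =
    ((q * r' - r * q') * a) *\<^sub>R x + ((r * p' - p * r') * b) *\<^sub>R y + ((p * q' - q * p') * c) *\<^sub>R z"
  using assms lie_algebra_expand[OF assms(1)] basis3D[of V x y z] by (simp add: milnor_basis_def)

lemma milnor_isomorphic: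
  assumes V: "lie_algebra V br" "milnor V br a b c" and W: "lie_algebra W br'" "milnor W br' a b c"
  shows "lie_isomorphic V br W br'"
proof -
  obtain x y z where M: "milnor_basis V br a b c x y z" using V by (auto simp: milnor_def)
  obtain x' y' z' where M': "milnor_basis W br' a b c x' y' z'" using W by (auto simp: milnor_def)
  have b: "basis3 V x y z" and b': "basis3 W x' y' z'" using M M' by (simp_all add: milnor_basis_def)
  obtain p q r where lin: "linear p" "linear q" "linear r"
    and d: "p x = 1" "p y = 0" "p z = 0" "q x = 0" "q y = 1" "q z = 0" "r x = 0" "r y = 0" "r z = (1::real)"
    and e: "\<And>u. u \<in> V \<Longrightarrow> u = p u *\<^sub>R x + q u *\<^sub>R y + r u *\<^sub>R z"
    by (rule basis3_dual[OF b]) blast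
  obtain p' q' r' where lin': "linear p'" "linear q'" "linear r'"
    and d': "p' x' = 1" "p' y' = 0" "p' z' = 0" "q' x' = 0" "q' y' = 1" "q' z' = 0"
      "r' x' = 0" "r' y' = 0" "r' z' = (1::real)"
    and e': "\<And>u. u \<in> W \<Longrightarrow> u = p' u *\<^sub>R x' + q' u *\<^sub>R y' + r' u *\<^sub>R z'"
    by (rule basis3_dual[OF b']) blast
  note S = linear_add[OF lin(1)] linear_add[OF lin(2)] linear_add[OF lin(3)]
    linear_scale[OF lin(1)] linear_scale[OF lin(2)] linear_scale[OF lin(3)] d
  note S' = linear_add[OF lin'(1)] linear_add[OF lin'(2)] linear_add[OF lin'(3)]
    linear_scale[OF lin'(1)] linear_scale[OF lin'(2)] linear_scale[OF lin'(3)] d'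
  have subs: "subspace V" "subspace W" using V W by (simp_all add: lie_algebra_def)
  define f where "f u = p u *\<^sub>R x' + q u *\<^sub>R y' + r u *\<^sub>R z'" for u
  define h where "h u = p' u *\<^sub>R x + q' u *\<^sub>R y + r' u *\<^sub>R z" for u
  have "bij_betw f V W"
  proof (rule bij_betw_byWitness[of _ h])
    show "\<forall>u\<in>V. h (f u) = u" using e by (simp add: h_def f_def S')
    show "\<forall>u\<in>W. f (h u) = u" using e' by (simp add: h_def f_def S)
    show "f ` V \<subseteq> W" using basis3D[OF b'] subs by (auto simp: f_def intro!: subspace_add subspace_scale)
    show "h ` W \<subseteq> V" using basis3D[OF b] subs by (auto simp: h_def intro!: subspace_add subspace_scale)
  qed
  moreover have "f (br u v) = br' (f u) (f v)" if "u \<in> V" "v \<in> V" for u v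
  proof -
    have "br u v = br (p u *\<^sub>R x + q u *\<^sub>R y + r u *\<^sub>R z) (p v *\<^sub>R x + q v *\<^sub>R y + r v *\<^sub>R z)"
      using e that by simp
    then show ?thesis
      unfolding milnor_basis_expand[OF V(1) M] f_def[of u] f_def[of v] milnor_basis_expand[OF W(1) M']
      by (simp add: f_def S)
  qed
  ultimately show ?thesis
    unfolding lie_isomorphic_def
    by (intro exI[of _ f]) (auto simp: f_def S algebra_simps)
qed

lemma milnor_dim: "milnor V br a b c \<Longrightarrow> dim V = 3"
  by (auto simp: milnor_def milnor_basis_def dest: basis3_dim)

lemma milnor_unimodular:
  assumes V: "lie_algebra V br" "milnor V br a b c"
  shows "unimodular V br"
  unfolding unimodular_def
proof
  fix u assume u: "u \<in> V"
  obtain x y z where M: "milnor_basis V br a b c x y z" using V by (auto simp: milnor_def)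
  then have b: "basis3 V x y z" by (simp add: milnor_basis_def)
  obtain p q r where lin: "linear p" "linear q" "linear r"
    and d: "p x = 1" "p y = 0" "p z = 0" "q x = 0" "q y = 1" "q z = 0" "r x = 0" "r y = 0" "r z = (1::real)"
    and e: "\<And>u. u \<in> V \<Longrightarrow> u = p u *\<^sub>R x + q u *\<^sub>R y + r u *\<^sub>R z"
    by (rule basis3_dual[OF b]) blast
  note S = linear_add[OF lin(1)] linear_add[OF lin(2)] linear_add[OF lin(3)]
    linear_scale[OF lin(1)] linear_scale[OF lin(2)] linear_scale[OF lin(3)] d
  have "span {x, y, z} = V" using b by (simp add: basis3_def)
  then have "endo_trace V (br u) = p (br u x) + q (br u y) + r (br u z)"
    by (rule endo_trace_basis3[OF _ lin d]) (use V(1) u in \<open>unfold lie_algebra_def, blast+\<close>)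
  moreover note X = milnor_basis_expand[OF V(1) M, of "p u" "q u" "r u"]
  have "br u x = br (p u *\<^sub>R x + q u *\<^sub>R y + r u *\<^sub>R z) (1 *\<^sub>R x + 0 *\<^sub>R y + 0 *\<^sub>R z)"
    "br u y = br (p u *\<^sub>R x + q u *\<^sub>R y + r u *\<^sub>R z) (0 *\<^sub>R x + 1 *\<^sub>R y + 0 *\<^sub>R z)"
    "br u z = br (p u *\<^sub>R x + q u *\<^sub>R y + r u *\<^sub>R z) (0 *\<^sub>R x + 0 *\<^sub>R y + 1 *\<^sub>R z)"
    using e[OF u] by simp_all
  ultimately show "endo_trace V (br u) = 0" unfolding X
    by (simp add: S linear_diff[OF lin(1)] linear_diff[OF lin(2)] linear_diff[OF lin(3)])
qed

section \<open>Rescaling and permuting the structure constants\<close>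

lemma milnor_rotate: "milnor V br a b c \<Longrightarrow> milnor V br b c a"
proof -
  assume "milnor V br a b c"
  then obtain x y z where M: "milnor_basis V br a b c x y z" by (auto simp: milnor_def)
  then have "milnor_basis V br b c a y z x"
    by (simp add: milnor_basis_def basis3_rotate)
  then show ?thesis unfolding milnor_def by blast
qed

lemma milnor_scale:
  assumes lie: "lie_algebra V br" and "milnor V br a b c" and st: "s \<noteq> 0" "t \<noteq> 0" "u \<noteq> 0"
  shows "milnor V br (a * t * u / s) (b * u * s / t) (c * s * t / u)"
proof -
  obtain x y z where M: "milnor_basis V br a b c x y z" using assms by (auto simp: milnor_def)
  then have b: "basis3 V x y z" by (simp add: milnor_basis_def)
  have X: "br (k *\<^sub>R v) (l *\<^sub>R w) = (k * l) *\<^sub>R br v w" if "v \<in> V" "w \<in> V" for v w k l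
  proof -
    have "subspace V" using lie by (simp add: lie_algebra_def)
    then have "l *\<^sub>R w \<in> V" using that by (simp add: subspace_scale)
    then have "br (k *\<^sub>R v) (l *\<^sub>R w) = k *\<^sub>R br v (l *\<^sub>R w)" "br v (l *\<^sub>R w) = l *\<^sub>R br v w"
      using lie that unfolding lie_algebra_def by blast+
    then show ?thesis by simp
  qed
  have "w \<in> span {s *\<^sub>R x, t *\<^sub>R y, u *\<^sub>R z} \<longleftrightarrow> w \<in> span {x, y, z}" for w
  proof
    assume "w \<in> span {x, y, z}"
    then obtain p q r where "w = p *\<^sub>R x + q *\<^sub>R y + r *\<^sub>R z" by (auto simp: span3)
    then have "w = (p / s) *\<^sub>R (s *\<^sub>R x) + (q / t) *\<^sub>R (t *\<^sub>R y) + (r / u) *\<^sub>R (u *\<^sub>R z)" using st by simp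
    then show "w \<in> span {s *\<^sub>R x, t *\<^sub>R y, u *\<^sub>R z}" unfolding span3 by blast
  next
    assume "w \<in> span {s *\<^sub>R x, t *\<^sub>R y, u *\<^sub>R z}"
    then show "w \<in> span {x, y, z}" unfolding span3 scaleR_scaleR by blast
  qed
  then have "basis3 V (s *\<^sub>R x) (t *\<^sub>R y) (u *\<^sub>R z)"
    using b st basis3_zero[OF b] unfolding basis3_def scaleR_scaleR by (metis no_zero_divisors subsetI subset_antisym)
  then have "milnor_basis V br (a * t * u / s) (b * u * s / t) (c * s * t / u) (s *\<^sub>R x) (t *\<^sub>R y) (u *\<^sub>R z)"
    using M st basis3D[OF b] by (simp add: milnor_basis_def X mult_ac)
  then show ?thesis unfolding milnor_def by blast
qed

text \<open>Negating the basis leaves the brackets of its members unchanged but reverses the vectors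
  in which they are expressed.\<close>

lemma milnor_uminus:
  assumes "lie_algebra V br" "milnor V br a b c"
  shows "milnor V br (- a) (- b) (- c)"
  using milnor_scale[OF assms, of "-1" "-1" "-1"] by simp

text \<open>Exchanging \<open>x\<close> and \<open>y\<close> reverses the orientation and gives
  \<open>- b\<close>, \<open>- a\<close>, \<open>- c\<close>; negating the whole basis restores the
  signs.\<close>

lemma milnor_swap:
  assumes lie: "lie_algebra V br" and "milnor V br a b c"
  shows "milnor V br b a c"
proof -
  obtain x y z where M: "milnor_basis V br a b c x y z" using assms by (auto simp: milnor_def)
  then have b: "basis3 V x y z" by (simp add: milnor_basis_def)
  have "milnor_basis V br (- b) (- a) (- c) y x z"
    using M basis3D[OF b] lie_algebra_skew[OF lie, of x y] lie_algebra_skew[OF lie, of y z]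
      lie_algebra_skew[OF lie, of z x]
    by (simp add: milnor_basis_def basis3_swap)
  then have "milnor V br (- b) (- a) (- c)" unfolding milnor_def by blast
  from milnor_uminus[OF lie this] show ?thesis by simp
qed

text \<open>The scaling factors must satisfy \<open>t u / s = 1 / |a|\<close> and its cyclic
  analogues, which is solved by \<open>s = 1 / sqrt (|b| |c|)\<close> and its rotations. A vanishing
  constant may be scaled arbitrarily, hence the value 1 of \<open>n\<close> at 0.\<close>

lemma milnor_sgn:
  assumes "lie_algebra V br" "milnor V br a b c"
  shows "milnor V br (sgn a) (sgn b) (sgn c)"
proof -
  define n where "n x = (if x = 0 then 1 else \<bar>x\<bar>)" for x :: real
  have n: "n x > 0" "x / n x = sgn x" for x by (auto simp: n_def sgn_if)
  have s: "x * (1 / sqrt (n z * n x)) * (1 / sqrt (n x * n y)) / (1 / sqrt (n y * n z)) = sgn x" for x y z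
  proof -
    have "sqrt (n x) * sqrt (n x) = n x" using n(1)[of x] by simp
    then have "x * (1 / sqrt (n z * n x)) * (1 / sqrt (n x * n y)) / (1 / sqrt (n y * n z)) = x / n x"
      using n(1)[of x] n(1)[of y] n(1)[of z] by (simp add: real_sqrt_mult field_simps)
    then show ?thesis using n by simp
  qed
  have "sqrt (n x * n y) \<noteq> 0" for x y using n(1)[of x] n(1)[of y] by simp
  then show ?thesis
    using milnor_scale[OF assms, of "1 / sqrt (n b * n c)" "1 / sqrt (n c * n a)" "1 / sqrt (n a * n b)"]
    by (simp only: s) simp
qed

text \<open>Permutations and a common change of sign act on the 27 sign patterns with six orbits,
  told apart by the number of zeros and by whether the non-zero signs agree.\<close>

lemma milnor_classification:
  assumes lie: "lie_algebra V br" and "milnor V br a b c"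
  shows "milnor V br 0 0 0 \<or> milnor V br 0 0 1 \<or> milnor V br 1 1 0 \<or> milnor V br 1 (- 1) 0
    \<or> milnor V br 1 1 1 \<or> milnor V br 1 1 (- 1)"
proof -
  note R = milnor_rotate[of V br] and S = milnor_swap[OF lie] and N = milnor_uminus[OF lie]
  have M: "milnor V br (sgn a) (sgn b) (sgn c)" by (rule milnor_sgn[OF assms])
  have "sgn a = 0 \<or> sgn a = 1 \<or> sgn a = -1" "sgn b = 0 \<or> sgn b = 1 \<or> sgn b = -1"
    "sgn c = 0 \<or> sgn c = 1 \<or> sgn c = -1" by (auto simp: sgn_if)
  then show ?thesis
    using M by (elim disjE; simp only:) (metis R S N minus_minus minus_zero)+
qed

lemma milnor_simple:
  assumes lie: "lie_algebra V br" and M: "milnor V br a b c" and nz: "a \<noteq> 0" "b \<noteq> 0" "c \<noteq> 0"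
  shows "lie_simple V br"
proof -
  obtain x y z where M: "milnor_basis V br a b c x y z" using M by (auto simp: milnor_def)
  then have b: "basis3 V x y z" by (simp add: milnor_basis_def)
  note V = basis3D[OF b]
  have "z \<noteq> 0" "x \<noteq> 0" "y \<noteq> 0"
    using b unfolding basis3_def by (metis add_0 scaleR_one scaleR_zero_left add_0_right zero_neq_one)+
  then have "br x y \<noteq> 0" using M nz by (simp add: milnor_basis_def)
  then have "\<not> lie_abelian V br" using V unfolding lie_abelian_def by blast
  moreover have "I = V" if I: "lie_ideal I V br" and "I \<noteq> {0}" for I
  proof -
    have sub: "subspace I" "I \<subseteq> V" and cl: "\<And>v w. v \<in> V \<Longrightarrow> w \<in> I \<Longrightarrow> br v w \<in> I"
      using I by (auto simp: lie_ideal_def)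
    have scale: "k *\<^sub>R v \<in> I \<Longrightarrow> k \<noteq> 0 \<Longrightarrow> v \<in> I" for k v
      using subspace_scale[OF sub(1), of "k *\<^sub>R v" "inverse k"] by simp
    \<comment> \<open>For \<open>w\<close> in the ideal with non-zero first coordinate
      \<open>p\<close>, bracketing with \<open>y'\<close> and then with \<open>x'\<close> isolates
      \<open>p c' b' y'\<close>; from \<open>y'\<close> one reaches \<open>z'\<close> and then
      \<open>x'\<close>. The basis is arbitrary here so that the other two coordinates follow by
      rotation.\<close>
    have full: "I = V" if "p *\<^sub>R x' + q *\<^sub>R y' + r *\<^sub>R z' \<in> I" "p \<noteq> 0" "a' \<noteq> 0" "b' \<noteq> 0" "c' \<noteq> 0"
      and M: "milnor_basis V br a' b' c' x' y' z'" for p q r x' y' z' a' b' c'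
    proof -
      have b: "basis3 V x' y' z'" using M by (simp add: milnor_basis_def)
      note V = basis3D[OF b]
      have "br x' (br y' (p *\<^sub>R x' + q *\<^sub>R y' + r *\<^sub>R z')) \<in> I" using V that by (intro cl)
      moreover have "br y' (p *\<^sub>R x' + q *\<^sub>R y' + r *\<^sub>R z') = (r * a') *\<^sub>R x' + 0 *\<^sub>R y' + (- p * c') *\<^sub>R z'"
        using milnor_basis_expand[OF lie M, of 0 1 0 p q r] by simp
      moreover have "br x' ((r * a') *\<^sub>R x' + 0 *\<^sub>R y' + (- p * c') *\<^sub>R z') = (p * c' * b') *\<^sub>R y'"
        using milnor_basis_expand[OF lie M, of 1 0 0 "r * a'" 0 "- p * c'"] by simp
      ultimately have y: "y' \<in> I" using that by (auto intro: scale)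
      have z: "z' \<in> I" using cl[OF V(1) y] M that by (auto simp: milnor_basis_def intro: scale)
      have "x' \<in> I" using cl[OF V(2) z] M that by (auto simp: milnor_basis_def intro: scale)
      then have "span {x', y', z'} \<subseteq> I" using y z sub by (intro span_minimal) auto
      then show "I = V" using b sub by (auto simp: basis3_def)
    qed
    obtain w where w: "w \<in> I" "w \<noteq> 0" using \<open>I \<noteq> {0}\<close> subspace_0[OF sub(1)] by auto
    obtain p q r where e: "w = p *\<^sub>R x + q *\<^sub>R y + r *\<^sub>R z"
      using basis3_expand[OF b] w sub by blast
    have R: "milnor_basis V br b' c' a' y' z' x'" if "milnor_basis V br a' b' c' x' y' z'" for a' b' c' x' y' z'
      using that by (simp add: milnor_basis_def basis3_rotate)
    have "p \<noteq> 0 \<or> q \<noteq> 0 \<or> r \<noteq> 0" using w e by auto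
    then show "I = V"
    proof (elim disjE)
      assume "p \<noteq> 0" then show ?thesis using full[OF _ _ nz M] w e by blast
    next
      assume "q \<noteq> 0" then show ?thesis
        using full[of q y r z p x b c a] R[OF M] nz w e by (simp add: ac_simps)
    next
      assume "r \<noteq> 0" then show ?thesis
        using full[of r z p x q y c a b] R[OF R[OF M]] nz w e by (simp add: ac_simps)
    qed
  qed
  ultimately show ?thesis unfolding lie_simple_def by blast
qed

lemma milnor_derived_algebra:
  assumes lie: "lie_algebra V br" and M: "milnor_basis V br 0 b c x y z" and nz: "b \<noteq> 0" "c \<noteq> 0"
  shows "derived_algebra V br = span {y, z}" "metabelian V br"
proof -
  have b: "basis3 V x y z" using M by (simp add: milnor_basis_def)
  note V = basis3D[OF b]
  show D: "derived_algebra V br = span {y, z}"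
    unfolding derived_algebra_def
  proof (rule subset_antisym)
    have "br u v \<in> span {y, z}" if "u \<in> V" "v \<in> V" for u v
    proof -
      obtain p q r where u: "u = p *\<^sub>R x + q *\<^sub>R y + r *\<^sub>R z" using basis3_expand[OF b \<open>u \<in> V\<close>] .
      obtain p' q' r' where v: "v = p' *\<^sub>R x + q' *\<^sub>R y + r' *\<^sub>R z" using basis3_expand[OF b \<open>v \<in> V\<close>] .
      show ?thesis unfolding u v milnor_basis_expand[OF lie M]
        by (auto intro!: span_add span_scale intro: span_base)
    qed
    then show "span {br x y |x y. x \<in> V \<and> y \<in> V} \<subseteq> span {y, z}"
      by (intro span_minimal) auto
    have "br z x \<in> span {br x y |x y. x \<in> V \<and> y \<in> V}" "br x y \<in> span {br x y |x y. x \<in> V \<and> y \<in> V}"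
      using V by (auto intro!: span_base)
    from span_scale[OF this(1), of "inverse b"] span_scale[OF this(2), of "inverse c"]
    show "span {y, z} \<subseteq> span {br x y |x y. x \<in> V \<and> y \<in> V}"
      using M nz by (intro span_minimal) (auto simp: milnor_basis_def)
  qed
  have sp: "\<exists>q r. u = 0 *\<^sub>R x + q *\<^sub>R y + r *\<^sub>R z" if u: "u \<in> span {y, z}" for u
  proof -
    obtain q where "u - q *\<^sub>R y \<in> span {z}" using u by (auto simp: span_breakdown_eq[of u y])
    then obtain r where "u - q *\<^sub>R y = r *\<^sub>R z" by (auto simp: span_singleton)
    then have "u = 0 *\<^sub>R x + q *\<^sub>R y + r *\<^sub>R z" by (simp add: algebra_simps)
    then show ?thesis by blast
  qed
  have "br u v = 0" if "u \<in> span {y, z}" "v \<in> span {y, z}" for u v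
  proof -
    obtain q r q' r' where "u = 0 *\<^sub>R x + q *\<^sub>R y + r *\<^sub>R z" "v = 0 *\<^sub>R x + q' *\<^sub>R y + r' *\<^sub>R z"
      using sp[OF \<open>u \<in> span {y, z}\<close>] sp[OF \<open>v \<in> span {y, z}\<close>] by blast
    then show ?thesis using milnor_basis_expand[OF lie M, of 0 q r 0 q' r'] by simp
  qed
  then show "metabelian V br" unfolding metabelian_def lie_abelian_def D by blast
qed

text \<open>An invariant that separates \<open>so(2,1)\<close> from \<open>so(3)\<close> and \<open>e(1,1)\<close> from \<open>e(2)\<close>.\<close>

definition has_real_weight :: "'v::real_vector set \<Rightarrow> ('v \<Rightarrow> 'v \<Rightarrow> 'v) \<Rightarrow> bool" where
  "has_real_weight V br \<longleftrightarrow> (\<exists>x\<in>V. \<exists>y\<in>V. y \<noteq> 0 \<and> br x y = y)"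

lemma has_real_weight_isomorphic:
  assumes "lie_isomorphic V br W br'" and lie: "lie_algebra V br"
  shows "has_real_weight V br \<longleftrightarrow> has_real_weight W br'"
proof -
  obtain f where f: "bij_betw f V W" "\<And>x c. x \<in> V \<Longrightarrow> f (c *\<^sub>R x) = c *\<^sub>R f x"
    and hom: "\<And>x y. x \<in> V \<Longrightarrow> y \<in> V \<Longrightarrow> f (br x y) = br' (f x) (f y)"
    using assms(1) by (auto simp: lie_isomorphic_def)
  have W: "W = f ` V" and inj: "\<And>x y. x \<in> V \<Longrightarrow> y \<in> V \<Longrightarrow> f x = f y \<longleftrightarrow> x = y"
    using f(1) by (auto simp: bij_betw_def inj_on_def)
  have V: "0 \<in> V" "\<And>x y. x \<in> V \<Longrightarrow> y \<in> V \<Longrightarrow> br x y \<in> V"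
    using lie by (auto simp: lie_algebra_def subspace_0)
  have "f 0 = 0" using f(2)[of 0 0] V by simp
  then have "y = 0 \<longleftrightarrow> f y = 0" if "y \<in> V" for y using inj[OF that V(1)] by simp
  moreover have "br x y = y \<longleftrightarrow> br' (f x) (f y) = f y" if "x \<in> V" "y \<in> V" for x y
    using inj[OF V(2)[OF that] that(2)] hom[OF that] by simp
  ultimately show ?thesis unfolding has_real_weight_def W by simp
qed

lemma milnor_has_real_weight:
  assumes lie: "lie_algebra V br" and "milnor V br 1 (- 1) c"
  shows "has_real_weight V br"
proof -
  obtain x y z where M: "milnor_basis V br 1 (- 1) c x y z" using assms by (auto simp: milnor_def)
  then have b: "basis3 V x y z" by (simp add: milnor_basis_def)
  note V = basis3D[OF b]
  have sub: "subspace V" using lie by (simp add: lie_algebra_def)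
  \<comment> \<open>The bracket with \<open>- z\<close> exchanges \<open>x\<close> and
    \<open>y\<close> when the first two constants are 1 and -1, so it fixes
    \<open>x + y\<close>.\<close>
  have "br (0 *\<^sub>R x + 0 *\<^sub>R y + (-1) *\<^sub>R z) (1 *\<^sub>R x + 1 *\<^sub>R y + 0 *\<^sub>R z) = 1 *\<^sub>R x + 1 *\<^sub>R y + 0 *\<^sub>R z"
    unfolding milnor_basis_expand[OF lie M] by simp
  moreover have "1 *\<^sub>R x + 1 *\<^sub>R y + 0 *\<^sub>R z \<noteq> 0" using b unfolding basis3_def by fastforce
  moreover have "0 *\<^sub>R x + 0 *\<^sub>R y + (-1) *\<^sub>R z \<in> V" "1 *\<^sub>R x + 1 *\<^sub>R y + 0 *\<^sub>R z \<in> V"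
    using V sub by (auto intro!: subspace_add subspace_scale subspace_neg)
  ultimately show ?thesis unfolding has_real_weight_def by blast
qed

text \<open>For \<open>c = 1\<close> the bracket is the Euclidean cross product in coordinates, so
  the bracket of \<open>u\<close> and \<open>v\<close> is orthogonal to \<open>v\<close> and can
  equal \<open>v\<close> only if \<open>v = 0\<close>. For \<open>c = 0\<close> the third coordinate
  of such a \<open>v\<close> vanishes first, and the same pairing applies.\<close>

lemma milnor_no_real_weight:
  assumes lie: "lie_algebra V br" and "milnor V br 1 1 c" and c: "c = 0 \<or> c = 1"
  shows "\<not> has_real_weight V br"
proof
  assume "has_real_weight V br"
  then obtain u v where uv: "u \<in> V" "v \<in> V" "v \<noteq> 0" "br u v = v" by (auto simp: has_real_weight_def)
  obtain x y z where M: "milnor_basis V br 1 1 c x y z" using assms by (auto simp: milnor_def)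
  then have b: "basis3 V x y z" by (simp add: milnor_basis_def)
  obtain p q r where u: "u = p *\<^sub>R x + q *\<^sub>R y + r *\<^sub>R z" using basis3_expand[OF b uv(1)] .
  obtain p' q' r' where v: "v = p' *\<^sub>R x + q' *\<^sub>R y + r' *\<^sub>R z" using basis3_expand[OF b uv(2)] .
  have "br u v - v = 0" using uv by simp
  then have "(q * r' - r * q' - p') *\<^sub>R x + (r * p' - p * r' - q') *\<^sub>R y + ((p * q' - q * p') * c - r') *\<^sub>R z = 0"
    unfolding u v milnor_basis_expand[OF lie M] by (simp add: algebra_simps)
  then have e: "p' = q * r' - r * q'" "q' = r * p' - p * r'" "r' = (p * q' - q * p') * c"
    using basis3_zero[OF b] by fastforce+
  have "p' * p' + q' * q' + r' * r' =
      p' * (q * r' - r * q') + q' * (r * p' - p * r') + r' * ((p * q' - q * p') * c)"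
    by (simp only: e[symmetric])
  moreover have "c = 0 \<Longrightarrow> r' = 0" using e(3) by simp
  ultimately have "p' * p' + q' * q' + r' * r' = 0"
    using c by (auto simp: algebra_simps)
  then have "p' = 0" "q' = 0" "r' = 0"
    by (metis add_nonneg_eq_0_iff add_nonneg_nonneg mult_eq_0_iff zero_le_square)+
  then show False using uv v by simp
qed

section \<open>The Lie algebras of the list\<close>

lemma lie_subalgebra:
  assumes "lie_algebra UNIV br" "subspace V" "\<And>x y. x \<in> V \<Longrightarrow> y \<in> V \<Longrightarrow> br x y \<in> V"
  shows "lie_algebra V br"
  using assms unfolding lie_algebra_def by blast

lemma bilinear_matrix_mult: "bilinear ((**) :: real^'n^'m \<Rightarrow> real^'p^'n \<Rightarrow> real^'p^'m)"
  by (auto simp: bilinear_def matrix_matrix_mult_def vec_eq_iff sum.distrib sum_distrib_left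
      algebra_simps intro!: linearI)

lemmas matrix_mult_simps = bilinear_ladd[OF bilinear_matrix_mult] bilinear_radd[OF bilinear_matrix_mult]
  bilinear_lmul[OF bilinear_matrix_mult] bilinear_rmul[OF bilinear_matrix_mult]
  bilinear_lsub[OF bilinear_matrix_mult] bilinear_rsub[OF bilinear_matrix_mult]
  bilinear_lneg[OF bilinear_matrix_mult] bilinear_rneg[OF bilinear_matrix_mult]
  bilinear_lzero[OF bilinear_matrix_mult] bilinear_rzero[OF bilinear_matrix_mult]

lemma lie_algebra_commutator: "lie_algebra UNIV (commutator :: real^'n^'n \<Rightarrow> _)"
  by (simp add: lie_algebra_def commutator_def matrix_mult_simps matrix_mul_assoc algebra_simps)

lemma lie_algebra_zero_bracket: "lie_algebra UNIV (zero_bracket :: 'v::real_vector \<Rightarrow> _)"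
  by (simp add: lie_algebra_def zero_bracket_def)

lemma mem_so_alg: "A \<in> so_alg s \<longleftrightarrow> (\<forall>i j. A $ j $ i * s $ j + s $ i * A $ i $ j = 0)"
  by (simp add: so_alg_def vec_eq_iff matrix_matrix_mult_def transpose_def diag_matrix_def
      if_distrib if_distribR cong: if_cong)

lemma subspace_so_alg: "subspace (so_alg s)"
  unfolding subspace_def mem_so_alg
proof (intro conjI ballI allI)
  fix A B c i j
  assume "A \<in> so_alg s"
  then have A: "A $ j $ i * s $ j + s $ i * A $ i $ j = 0" by (simp add: mem_so_alg)
  then have "c * (A $ j $ i * s $ j + s $ i * A $ i $ j) = 0" by simp
  then show "(c *\<^sub>R A) $ j $ i * s $ j + s $ i * (c *\<^sub>R A) $ i $ j = 0"
    by (simp add: algebra_simps)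
  assume "B \<in> so_alg s"
  then have "B $ j $ i * s $ j + s $ i * B $ i $ j = 0" by (simp add: mem_so_alg)
  with A show "(A + B) $ j $ i * s $ j + s $ i * (A + B) $ i $ j = 0"
    by (simp add: algebra_simps)
qed simp

lemma commutator_so_alg:
  assumes "A \<in> so_alg s" "B \<in> so_alg s"
  shows "commutator A B \<in> so_alg s"
proof -
  let ?S = "diag_matrix s"
  have A: "transpose A ** ?S = - (?S ** A)" and B: "transpose B ** ?S = - (?S ** B)"
    using assms by (simp_all add: so_alg_def eq_neg_iff_add_eq_0)
  have tr: "transpose (X - Y) = transpose X - transpose Y" for X Y :: "real^'a^'a"
    by (simp add: transpose_def vec_eq_iff)
  have "transpose (commutator A B) ** ?S = transpose B ** (transpose A ** ?S) - transpose A ** (transpose B ** ?S)"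
    by (simp add: commutator_def tr matrix_transpose_mul matrix_mult_simps matrix_mul_assoc)
  also have "\<dots> = (transpose A ** ?S) ** B - (transpose B ** ?S) ** A"
    unfolding A B by (simp add: matrix_mult_simps matrix_mul_assoc A B)
  also have "\<dots> = - (?S ** commutator A B)"
    unfolding A B by (simp add: commutator_def matrix_mult_simps matrix_mul_assoc)
  finally show ?thesis by (simp add: so_alg_def)
qed

lemma lie_algebra_so_alg: "lie_algebra (so_alg s) commutator"
  by (rule lie_subalgebra[OF lie_algebra_commutator subspace_so_alg commutator_so_alg])

lemma lie_algebra_e_alg: "lie_algebra (e_alg s) e_bracket"
proof (rule lie_subalgebra)
  have *: "commutator (A + B) C = commutator A C + commutator B C" "commutator C (A + B) = commutator C A + commutator C B"
    "commutator (c *\<^sub>R A) B = c *\<^sub>R commutator A B" "commutator A (c *\<^sub>R B) = c *\<^sub>R commutator A B"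
    "commutator A A = 0" "commutator A (commutator B C) + commutator B (commutator C A) + commutator C (commutator A B) = 0"
    for A B C :: "real^'a^'a" and c
    using lie_algebra_commutator[where 'n='a] unfolding lie_algebra_def by auto
  have **: "A *v (B *v x - C *v y) - (B ** C - C ** B) *v z + (B *v (C *v z - A *v x) - (C ** A - A ** C) *v y)
     + (C *v (A *v y - B *v z) - (A ** B - B ** A) *v x) = 0" for A B C :: "real^'a^'a" and x y z
    by (simp add: matrix_vector_mult_diff_distrib matrix_vector_mult_diff_rdistrib matrix_vector_mul_assoc)
  show "lie_algebra UNIV (e_bracket :: (real^'a^'a) \<times> (real^'a) \<Rightarrow> _)"
    unfolding lie_algebra_def
  proof (intro conjI ballI allI)
    fix x y z :: "(real^'a^'a) \<times> (real^'a)"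
    show "e_bracket x (e_bracket y z) + e_bracket y (e_bracket z x) + e_bracket z (e_bracket x y) = 0"
      using *(6)[of "fst x" "fst y" "fst z"] **[of "fst x" "fst y" "snd z" "fst z" "snd y" "snd x"]
      by (simp add: e_bracket_def prod_eq_iff) (simp add: commutator_def)
  qed (simp_all add: e_bracket_def prod_eq_iff * matrix_vector_mult_add_rdistrib matrix_vector_right_distrib
      scaleR_matrix_vector_assoc matrix_vector_mult_scaleR algebra_simps)
  show "subspace (e_alg s)"
    unfolding e_alg_def using subspace_so_alg by (rule subspace_Times) simp
qed (auto simp: e_alg_def e_bracket_def intro: commutator_so_alg)

lemma basis3I:
  assumes "subspace V" "x \<in> V" "y \<in> V" "z \<in> V"
    and "\<And>u. u \<in> V \<Longrightarrow> \<exists>p q r. u = p *\<^sub>R x + q *\<^sub>R y + r *\<^sub>R z"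
    and "\<And>p q r. p *\<^sub>R x + q *\<^sub>R y + r *\<^sub>R z = 0 \<Longrightarrow> p = 0 \<and> q = 0 \<and> r = 0"
  shows "basis3 V x y z"
proof -
  have "span {x, y, z} = V"
    by (rule span_subspace) (use assms(1-5) in \<open>auto simp: span3\<close>)
  then show ?thesis using assms(6) unfolding basis3_def by blast
qed

lemmas matrix3_simps = vec_eq_iff forall_3 sum_3 matrix_matrix_mult_def commutator_def

lemma milnor_so3: "milnor so3 commutator 1 1 1"
proof -
  let ?x = "vector [vector [0, 0, 0], vector [0, 0, -1], vector [0, 1, 0]] :: real^3^3"
  let ?y = "vector [vector [0, 0, 1], vector [0, 0, 0], vector [-1, 0, 0]] :: real^3^3"
  let ?z = "vector [vector [0, -1, 0], vector [1, 0, 0], vector [0, 0, 0]] :: real^3^3"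
  have "basis3 so3 ?x ?y ?z"
  proof (rule basis3I[OF subspace_so_alg])
    fix u assume "u \<in> so3"
    then show "\<exists>p q r. u = p *\<^sub>R ?x + q *\<^sub>R ?y + r *\<^sub>R ?z"
      by (intro exI[of _ "u $ 3 $ 2"] exI[of _ "u $ 1 $ 3"] exI[of _ "u $ 2 $ 1"])
        (auto simp: mem_so_alg matrix3_simps)
  qed (simp_all add: mem_so_alg matrix3_simps)
  then have "milnor_basis so3 commutator 1 1 1 ?x ?y ?z"
    by (simp add: milnor_basis_def matrix3_simps)
  then show ?thesis unfolding milnor_def by blast
qed

text \<open>\<open>?x\<close> and \<open>?y\<close> are infinitesimal boosts and \<open>?z\<close>
  is a rotation; the bracket of two boosts is a rotation of the opposite sense, whence the constant
  -1.\<close>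

lemma milnor_so21: "milnor so21 commutator 1 1 (- 1)"
proof -
  let ?x = "vector [vector [0, 0, 0], vector [0, 0, -1], vector [0, -1, 0]] :: real^3^3"
  let ?y = "vector [vector [0, 0, 1], vector [0, 0, 0], vector [1, 0, 0]] :: real^3^3"
  let ?z = "vector [vector [0, -1, 0], vector [1, 0, 0], vector [0, 0, 0]] :: real^3^3"
  have "basis3 so21 ?x ?y ?z"
  proof (rule basis3I[OF subspace_so_alg])
    fix u assume "u \<in> so21"
    then show "\<exists>p q r. u = p *\<^sub>R ?x + q *\<^sub>R ?y + r *\<^sub>R ?z"
      by (intro exI[of _ "- u $ 3 $ 2"] exI[of _ "u $ 1 $ 3"] exI[of _ "u $ 2 $ 1"])
        (auto simp: mem_so_alg matrix3_simps)
  qed (simp_all add: mem_so_alg matrix3_simps)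
  then have "milnor_basis so21 commutator 1 1 (- 1) ?x ?y ?z"
    by (simp add: milnor_basis_def matrix3_simps)
  then show ?thesis unfolding milnor_def by blast
qed

lemma lie_algebra_heis: "lie_algebra heis commutator"
  and milnor_heis: "milnor heis commutator 0 0 1"
proof -
  have mem: "A \<in> heis \<longleftrightarrow> A $ 1 $ 1 = 0 \<and> A $ 2 $ 1 = 0 \<and> A $ 2 $ 2 = 0 \<and> A $ 3 $ 1 = 0
      \<and> A $ 3 $ 2 = 0 \<and> A $ 3 $ 3 = 0" for A
    by (auto simp: heis_def vec_eq_iff forall_3)
  have sub: "subspace heis" by (auto simp: subspace_def mem)
  show "lie_algebra heis commutator"
    by (rule lie_subalgebra[OF lie_algebra_commutator sub]) (auto simp: mem matrix3_simps)
  let ?x = "vector [vector [0, 1, 0], vector [0, 0, 0], vector [0, 0, 0]] :: real^3^3"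
  let ?y = "vector [vector [0, 0, 0], vector [0, 0, 1], vector [0, 0, 0]] :: real^3^3"
  let ?z = "vector [vector [0, 0, 1], vector [0, 0, 0], vector [0, 0, 0]] :: real^3^3"
  have "basis3 heis ?x ?y ?z"
  proof (rule basis3I[OF sub])
    fix u assume "u \<in> heis"
    then show "\<exists>p q r. u = p *\<^sub>R ?x + q *\<^sub>R ?y + r *\<^sub>R ?z"
      by (intro exI[of _ "u $ 1 $ 2"] exI[of _ "u $ 2 $ 3"] exI[of _ "u $ 1 $ 3"])
        (auto simp: mem matrix3_simps)
  qed (simp_all add: mem matrix3_simps)
  then have "milnor_basis heis commutator 0 0 1 ?x ?y ?z"
    by (simp add: milnor_basis_def matrix3_simps)
  then show "milnor heis commutator 0 0 1" unfolding milnor_def by blast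
qed

lemma subspace_e_alg: "subspace (e_alg s)"
  using lie_algebra_e_alg[of s] by (simp add: lie_algebra_def)

lemmas matrix2_simps = vec_eq_iff forall_2 sum_2 matrix_matrix_mult_def matrix_vector_mult_def
  commutator_def e_bracket_def prod_eq_iff

lemma milnor_e2: "milnor e2 e_bracket 1 1 0"
proof -
  let ?x = "(0, vector [1, 0]) :: (real^2^2) \<times> (real^2)"
  let ?y = "(0, vector [0, 1]) :: (real^2^2) \<times> (real^2)"
  let ?z = "(vector [vector [0, -1], vector [1, 0]], 0) :: (real^2^2) \<times> (real^2)"
  have "basis3 e2 ?x ?y ?z"
  proof (rule basis3I[OF subspace_e_alg])
    fix u assume "u \<in> e2"
    then show "\<exists>p q r. u = p *\<^sub>R ?x + q *\<^sub>R ?y + r *\<^sub>R ?z"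
      by (intro exI[of _ "snd u $ 1"] exI[of _ "snd u $ 2"] exI[of _ "fst u $ 2 $ 1"])
        (auto simp: e_alg_def mem_so_alg matrix2_simps)
  qed (auto simp: e_alg_def mem_so_alg matrix2_simps)
  then have "milnor_basis e2 e_bracket 1 1 0 ?x ?y ?z"
    by (simp add: milnor_basis_def matrix2_simps)
  then show ?thesis unfolding milnor_def by blast
qed

text \<open>\<open>?x\<close> and \<open>?y\<close> are translations and \<open>?z\<close> is a
  negated infinitesimal boost; the sign is chosen so that the bracket of \<open>?y\<close> and
  \<open>?z\<close> is \<open>+ ?x\<close>.\<close>

lemma milnor_e11: "milnor e11 e_bracket 1 (- 1) 0"
proof -
  let ?x = "(0, vector [1, 0]) :: (real^2^2) \<times> (real^2)"
  let ?y = "(0, vector [0, 1]) :: (real^2^2) \<times> (real^2)"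
  let ?z = "(vector [vector [0, -1], vector [-1, 0]], 0) :: (real^2^2) \<times> (real^2)"
  have "basis3 e11 ?x ?y ?z"
  proof (rule basis3I[OF subspace_e_alg])
    fix u assume "u \<in> e11"
    then show "\<exists>p q r. u = p *\<^sub>R ?x + q *\<^sub>R ?y + r *\<^sub>R ?z"
      by (intro exI[of _ "snd u $ 1"] exI[of _ "snd u $ 2"] exI[of _ "- fst u $ 2 $ 1"])
        (auto simp: e_alg_def mem_so_alg matrix2_simps)
  qed (auto simp: e_alg_def mem_so_alg matrix2_simps)
  then have "milnor_basis e11 e_bracket 1 (- 1) 0 ?x ?y ?z"
    by (simp add: milnor_basis_def matrix2_simps)
  then show ?thesis unfolding milnor_def by blast
qed

lemma milnor_zero_bracket: "milnor (UNIV :: (real^3) set) zero_bracket 0 0 0"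
proof -
  let ?x = "vector [1, 0, 0] :: real^3"
  let ?y = "vector [0, 1, 0] :: real^3"
  let ?z = "vector [0, 0, 1] :: real^3"
  have "basis3 UNIV ?x ?y ?z"
  proof (rule basis3I)
    fix u :: "real^3"
    show "\<exists>p q r. u = p *\<^sub>R ?x + q *\<^sub>R ?y + r *\<^sub>R ?z"
      by (intro exI[of _ "u $ 1"] exI[of _ "u $ 2"] exI[of _ "u $ 3"]) (simp add: matrix3_simps)
  qed (simp_all add: matrix3_simps)
  then have "milnor_basis UNIV zero_bracket 0 0 0 ?x ?y ?z"
    by (simp add: milnor_basis_def zero_bracket_def)
  then show ?thesis unfolding milnor_def by blast
qed

lemma endo_trace_zero: "endo_trace V (\<lambda>x. 0) = 0"
  by (simp add: endo_trace_def representation_zero)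

text \<open>For an abelian bracket and \<open>H = 0\<close> the Dorfman bracket vanishes, so
  \<open>D = 0\<close> is a witness for every metric. This accounts for the words "of any signature"
  in the first class.\<close>

lemma abelian_gen_einstein:
  fixes br :: "'a::euclidean_space \<Rightarrow> 'a \<Rightarrow> 'a"
  assumes "lie_abelian UNIV br" and g: "pseudo_metric g"
  shows "gen_einstein br (\<lambda>_ _ _. 0) g 0"
proof -
  have Bl0: "Blinfun (\<lambda>x. 0::real) = (0::'a \<Rightarrow>\<^sub>L real)"
    by (rule blinfun_eqI) (simp add: bounded_linear_Blinfun_apply)
  have br: "br x y = 0" for x y using assms by (simp add: lie_abelian_def)
  have "coad br x \<eta> = 0" for x \<eta> by (simp add: coad_def br Bl0)
  then have dorf: "dorfman br (\<lambda>_ _ _. 0) u v = 0" for u v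
    by (simp add: dorfman_def br Bl0 zero_prod_def)
  have "g 0 = (\<lambda>x. 0)" using bilinear_lzero[OF pseudo_metricD(1)[OF g]] by auto
  then have "0 \<in> E_plus g" "0 \<in> E_minus g"
    by (auto simp: E_plus_def E_minus_def Bl0 zero_prod_def intro!: image_eqI[of _ _ 0])
  moreover have "pairing_adjoint (\<lambda>w. 0) v = (0::'a gen)" for v
    by (rule pairing_adjoint_zero) (simp add: pairing_def)
  moreover have "gen_connection (\<lambda>u v::'a gen. 0)"
    by (auto simp: gen_connection_def bilinear_def pairing_def linear_zero)
  ultimately have "gen_levi_civita br (\<lambda>_ _ _. 0) g (\<lambda>u v. 0)"
    by (auto simp: gen_levi_civita_def gen_torsion_def dorf)
  then show ?thesis
    unfolding gen_einstein_def
    by (intro conjI exI[of _ "\<lambda>u v. 0"])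
      (auto simp: g three_form_zero gen_divergence_def Ric_plus_def Ric_minus_def curvature_def endo_trace_zero)
qed

section \<open>Classification\<close>

lemma basis3_of_independent:
  fixes x y z :: "'a::euclidean_space"
  assumes "DIM('a) = 3" "\<And>p q r. p *\<^sub>R x + q *\<^sub>R y + r *\<^sub>R z = 0 \<Longrightarrow> p = 0 \<and> q = 0 \<and> r = 0"
  shows "basis3 UNIV x y z"
proof -
  have b: "basis3 (span {x, y, z}) x y z" using assms(2) unfolding basis3_def by blast
  have "span {x, y, z} = UNIV"
    using basis3_dim[OF b] assms(1) by (metis dim_eq_full dim_span)
  then show ?thesis using b by simp
qed

lemma basis3_of_span:
  fixes x y z :: "'a::euclidean_space"
  assumes dim: "DIM('a) = 3" and sp: "span {x, y, z} = UNIV"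
  shows "basis3 UNIV x y z"
proof -
  have 3: "3 \<le> card {x, y, z}" using dim_le_card[of UNIV "{x, y, z}"] sp dim by simp
  have 2: "card {u, v} \<le> 2" for u v :: 'a by (simp add: card_insert_if)
  have d: "x \<noteq> y" "y \<noteq> z" "z \<noteq> x"
    using 3 2[of y z] 2[of x z] 2[of z y] by (auto simp: insert_commute)
  have ind: "independent {x, y, z}"
    using card_le_dim_spanning[of "{x, y, z}" UNIV] sp dim d by simp
  have "\<exists>f. linear f \<and> (\<forall>u\<in>{x, y, z}. f u = (if u = w then 1 else 0::real))" for w
    by (rule linear_independent_extend[OF ind])
  then obtain f where f: "\<And>w. linear (f w)" "\<And>u w. u \<in> {x, y, z} \<Longrightarrow> f w u = (if u = w then 1 else 0::real)"
    by metis
  have "p = 0 \<and> q = 0 \<and> r = 0" if "p *\<^sub>R x + q *\<^sub>R y + r *\<^sub>R z = 0" for p q r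
  proof -
    have "f w (p *\<^sub>R x + q *\<^sub>R y + r *\<^sub>R z) = 0" for w by (simp add: that linear_0[OF f(1)])
    then have "p * f w x + q * f w y + r * f w z = 0" for w
      by (simp add: linear_add[OF f(1)] linear_scale[OF f(1)])
    from this[of x] this[of y] this[of z] show ?thesis using d f(2) by simp
  qed
  then show ?thesis by (rule basis3_of_independent[OF dim])
qed

section \<open>Normal forms of the bracket read off from a frame\<close>

context unimodular_frame
begin

lemma cross_frame: "cross u1 u2 = s3 *\<^sub>R u3" "cross u2 u3 = s1 *\<^sub>R u1" "cross u3 u1 = s2 *\<^sub>R u2"
  by (rule frame_eqI; simp add: g_simps mult_ac)+

lemma frame_basis3: "basis3 UNIV u1 u2 u3"
proof -
  have "p = 0 \<and> q = 0 \<and> r = 0" if "p *\<^sub>R u1 + q *\<^sub>R u2 + r *\<^sub>R u3 = 0" for p q r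
    using arg_cong[OF that, of "\<lambda>x. g x u1"] arg_cong[OF that, of "\<lambda>x. g x u2"]
      arg_cong[OF that, of "\<lambda>x. g x u3"] signs by (auto simp: g_simps)
  then show ?thesis using frame_span unfolding basis3_def by blast
qed

lemma DIM_3: "DIM('a) = 3"
  using basis3_dim[OF frame_basis3] by simp

lemma triple_basis3:
  assumes "g (cross x y) z \<noteq> 0"
  shows "basis3 UNIV x y z"
proof (rule basis3_of_independent[OF DIM_3])
  fix p q r assume 0: "p *\<^sub>R x + q *\<^sub>R y + r *\<^sub>R z = 0"
  have "g (cross (p *\<^sub>R x + q *\<^sub>R y + r *\<^sub>R z) y) z = p * g (cross x y) z"
    "g (cross x (p *\<^sub>R x + q *\<^sub>R y + r *\<^sub>R z)) z = q * g (cross x y) z"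
    "g (cross x y) (p *\<^sub>R x + q *\<^sub>R y + r *\<^sub>R z) = r * g (cross x y) z"
    by (simp_all add: cross_simps g_simps)
  then show "p = 0 \<and> q = 0 \<and> r = 0" unfolding 0 using assms by (simp add: cross_simps g_simps)
qed

text \<open>If the volume were zero, \<open>cross x y\<close> would pair to zero with the whole
  basis and hence vanish; the double product formula then gives a linear relation between
  \<open>x\<close> and \<open>y\<close>.\<close>

lemma triple_nonzero:
  assumes b: "basis3 UNIV x y z"
  shows "g (cross x y) z \<noteq> 0"
proof
  assume 0: "g (cross x y) z = 0"
  have "g (cross x y) w = 0" for w
  proof -
    obtain p q r where "w = p *\<^sub>R x + q *\<^sub>R y + r *\<^sub>R z" using basis3_expand[OF b] by blast
    then show ?thesis using 0 by (simp add: g_simps)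
  qed
  then have "cross x y = 0" by (intro pseudo_metricD(3)[OF metric]) 
  then have "(s1 * s2 * s3) *\<^sub>R (g x w *\<^sub>R y - g y w *\<^sub>R x) = 0" for w
    by (simp add: cross_cross[symmetric] cross_simps)
  then have "(- g y w) *\<^sub>R x + g x w *\<^sub>R y + 0 *\<^sub>R z = 0" for w
    using signs by auto
  then have "g x w = 0" for w using basis3_zero[OF b] by blast
  then have "x = 0" by (intro pseudo_metricD(3)[OF metric]) 
  then show False using basis3_zero[OF b, of 1 0 0] by simp
qed

text \<open>Only the symmetric form \<open>g (L x) y\<close> is diagonalised; its orthogonal basis
  \<open>x, y, z\<close> need not be orthogonal for \<open>g\<close>. Since \<open>L x\<close> pairs
  to zero with \<open>y\<close> and \<open>z\<close>, it is a multiple of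
  \<open>y \<times> z\<close>. The cross products \<open>y \<times> z\<close>,
  \<open>z \<times> x\<close>, \<open>x \<times> y\<close> form the Milnor basis, because the cross
  product of two of them is a multiple of the vector they share.\<close>

lemma exists_milnor: "\<exists>a b c. milnor UNIV br a b c"
proof -
  have "bilinear (\<lambda>x y. g (L x) y)"
    by (auto simp: bilinear_def linear_add[OF linear_L] linear_scale[OF linear_L] g_simps intro!: linearI)
  moreover have L_sym: "g (L x) y = g (L y) x" for x y by (metis L_self_adjoint g_sym)
  ultimately obtain x y z where sp: "span {x, y, z} = UNIV"
    and o: "g (L x) y = 0" "g (L y) z = 0" "g (L z) x = 0"
    by (rule exists_orthogonal_basis3[OF DIM_3])
  have o': "g (L y) x = 0" "g (L z) y = 0" "g (L x) z = 0"
    using o L_sym by metis+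
  define d where "d = g (cross x y) z"
  have xyz: "basis3 UNIV x y z" by (rule basis3_of_span[OF DIM_3 sp])
  have d: "d \<noteq> 0" using triple_nonzero[OF xyz] by (simp add: d_def)
  have tr: "g (cross x y) z = d" "g (cross y z) x = d" "g (cross z x) y = d"
    by (metis d_def triple_cyclic)+
  have eq: "u = v" if "g u x = g v x" "g u y = g v y" "g u z = g v z" for u v
  proof (rule eqI)
    fix w
    obtain p q r where "w = p *\<^sub>R x + q *\<^sub>R y + r *\<^sub>R z" using basis3_expand[OF xyz] by blast
    then show "g u w = g v w" using that by (simp add: g_simps)
  qed
  define a b c where "a = g (L x) x" and "b = g (L y) y" and "c = g (L z) z"
  have Lxyz: "L x = (a / d) *\<^sub>R cross y z" "L y = (b / d) *\<^sub>R cross z x" "L z = (c / d) *\<^sub>R cross x y"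
    by (rule eq; use d in \<open>simp add: g_simps tr o o' a_def b_def c_def\<close>)+
  have cc: "cross (cross z x) (cross x y) = (s1 * s2 * s3 * d) *\<^sub>R x"
    "cross (cross x y) (cross y z) = (s1 * s2 * s3 * d) *\<^sub>R y"
    "cross (cross y z) (cross z x) = (s1 * s2 * s3 * d) *\<^sub>R z"
    by (simp_all add: cross_cross tr g_sym[of _ "cross _ _"])
  have "g (cross (cross y z) (cross z x)) (cross x y) \<noteq> 0"
    using d signs by (auto simp: cc g_simps tr g_sym[of z])
  then have "basis3 UNIV (cross y z) (cross z x) (cross x y)" by (rule triple_basis3)
  then have "milnor_basis UNIV br (s1 * s2 * s3 * a) (s1 * s2 * s3 * b) (s1 * s2 * s3 * c)
      (cross y z) (cross z x) (cross x y)"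
    using d by (simp add: milnor_basis_def br_eq cc linear_scale[OF linear_L] Lxyz)
  then show ?thesis unfolding milnor_def by blast
qed

lemma frame_definite:
  assumes "s1 = s2" "s2 = s3"
  shows "definite_on UNIV g" "\<not> indefinite g"
proof -
  define Q where "Q x = (g x u1)\<^sup>2 + (g x u2)\<^sup>2 + (g x u3)\<^sup>2" for x
  have g: "g x x = s1 * Q x" for x
    using assms frame_g[of x x] by (simp add: Q_def power2_eq_square algebra_simps)
  have pos: "Q x \<ge> 0" for x by (simp add: Q_def)
  have "Q x > 0" if "x \<noteq> 0" for x
  proof (rule ccontr)
    assume "\<not> ?thesis"
    then have "Q x = 0" using pos[of x] by linarith
    then have "g x u1 = 0 \<and> g x u2 = 0 \<and> g x u3 = 0" by (simp add: Q_def add_nonneg_eq_0_iff)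
    then have "x = 0" by (intro frame_eqI) (simp_all add: g_simps)
    then show False using that by simp
  qed
  then show "definite_on UNIV g" using signs(1) unfolding definite_on_def g by auto
  show "\<not> indefinite g" using signs(1) pos unfolding indefinite_def g by (auto simp: not_less)
qed

lemma frame_indefinite:
  assumes "\<not> (s1 = s2 \<and> s2 = s3)"
  shows "\<not> definite_on UNIV g" "indefinite g"
proof -
  have "(g u1 u1 > 0 \<or> g u2 u2 > 0 \<or> g u3 u3 > 0) \<and> (g u1 u1 < 0 \<or> g u2 u2 < 0 \<or> g u3 u3 < 0)"
    using assms signs by auto
  then show "indefinite g" unfolding indefinite_def by blast
  moreover have "u1 \<noteq> 0" "u2 \<noteq> 0" "u3 \<noteq> 0"
    using basis3_zero[OF frame_basis3, of 1 0 0] basis3_zero[OF frame_basis3, of 0 1 0]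
      basis3_zero[OF frame_basis3, of 0 0 1] by auto
  ultimately show "\<not> definite_on UNIV g"
    unfolding indefinite_def definite_on_def
    by (metis UNIV_I bilinear_lzero[OF g_bil] less_asym less_irrefl)
qed

lemma not_isomorphic_real_weight:
  assumes "milnor UNIV br 1 (- 1) c" "milnor V br' 1 1 c'" "c' = 0 \<or> c' = 1" "lie_algebra V br'"
  shows "\<not> lie_isomorphic UNIV br V br'"
  using milnor_has_real_weight[OF lie assms(1)] milnor_no_real_weight[OF assms(4,2,3)]
    has_real_weight_isomorphic[OF _ lie] by blast

text \<open>Here \<open>L = 3c - c = 2c\<close>, so the bracket is \<open>2c\<close> times the cross
  product and the Milnor constants are \<open>2c\<close> times the signs of the metric: equal signs
  mean both that \<open>g\<close> is definite and that the algebra is \<open>so(3)\<close>. The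
  connection is \<open>c\<close> times the cross product, and the Jacobi identity reduces the
  curvature to \<open>- c\<^sup>2 (x \<times> y) \<times> z\<close>.\<close>

lemma scalar_case:
  assumes M: "\<And>x. M x = c *\<^sub>R x" and c: "c \<noteq> 0"
  shows "lie_simple UNIV br" "\<exists>k. k \<noteq> 0 \<and> constant_curvature br g k"
    "definite_on UNIV g \<longleftrightarrow> lie_isomorphic UNIV br so3 commutator"
    "indefinite g \<longleftrightarrow> lie_isomorphic UNIV br so21 commutator"
proof -
  have L: "L x = (2 * c) *\<^sub>R x" for x
    by (simp add: L_eq M g_simps algebra_simps flip: scaleR_left_distrib)
  have "milnor_basis UNIV br (2 * c * s1) (2 * c * s2) (2 * c * s3) u1 u2 u3"
    by (simp add: milnor_basis_def frame_basis3 br_eq cross_frame L)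
  then have mil: "milnor UNIV br (2 * c * s1) (2 * c * s2) (2 * c * s3)" unfolding milnor_def by blast
  show "lie_simple UNIV br" by (rule milnor_simple[OF lie mil]) (use c signs in auto)
  let ?nab = "bismut br g (\<lambda>x y z. 0)"
  have nab: "?nab x y = c *\<^sub>R cross x y" for x y
    by (simp add: bismut_eq[OF three_form_zero] M cross_simps)
  have "curvature br ?nab x y z = (c * c * (s1 * s2 * s3)) *\<^sub>R (g y z *\<^sub>R x - g x z *\<^sub>R y)" for x y z
  proof -
    have "curvature br ?nab x y z =
        (c * c) *\<^sub>R (cross x (cross y z) - cross y (cross x z) - 2 *\<^sub>R cross (cross x y) z)"
      by (simp add: curvature_def nab br_eq L cross_simps algebra_simps)
    also have "\<dots> = - (c * c) *\<^sub>R cross (cross x y) z"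
      by (simp add: cross_jacobi algebra_simps flip: scaleR_left_distrib)
    finally show ?thesis by (simp add: cross_cross algebra_simps)
  qed
  then have "constant_curvature br g (c * c * (s1 * s2 * s3))"
    unfolding constant_curvature_def using levi_civita_bismut by blast
  moreover have "c * c * (s1 * s2 * s3) \<noteq> 0" using c signs by auto
  ultimately show "\<exists>k. k \<noteq> 0 \<and> constant_curvature br g k" by blast
  have sgn_s: "sgn (2 * c * s1) = sgn c * s1" "sgn (2 * c * s2) = sgn c * s2" "sgn (2 * c * s3) = sgn c * s3"
    using signs by (auto simp: sgn_mult)
  have "milnor UNIV br (sgn c * s1) (sgn c * s2) (sgn c * s3)"
    using milnor_sgn[OF lie mil] by (simp only: sgn_s)
  then have s: "milnor UNIV br s1 s2 s3"
    using milnor_uminus[OF lie, of "- s1" "- s2" "- s3"] c by (cases "c > 0") auto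
  note R = milnor_rotate[of UNIV br] and N = milnor_uminus[OF lie]
  have "(definite_on UNIV g \<longleftrightarrow> lie_isomorphic UNIV br so3 commutator) \<and>
      (indefinite g \<longleftrightarrow> lie_isomorphic UNIV br so21 commutator)"
  proof (cases "s1 = s2 \<and> s2 = s3")
    case True
    then have m: "milnor UNIV br 1 1 1" using s N[of "-1" "-1" "-1"] signs(1) by auto
    then have "\<not> has_real_weight UNIV br" by (intro milnor_no_real_weight[OF lie]) auto
    moreover have "has_real_weight so21 commutator"
      using milnor_has_real_weight[OF lie_algebra_so_alg] milnor_rotate[OF milnor_so21] by blast
    ultimately have "\<not> lie_isomorphic UNIV br so21 commutator"
      using has_real_weight_isomorphic[OF _ lie] by blast
    then show ?thesis
      using frame_definite True milnor_isomorphic[OF lie m lie_algebra_so_alg milnor_so3] by simp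
  next
    case False
    then have m: "milnor UNIV br 1 1 (- 1)"
      using s signs N[of s1 s2 s3] R[of s1 s2 s3] R[of s2 s3 s1]
        R[of "-s1" "-s2" "-s3"] R[of "-s2" "-s3" "-s1"] by auto
    have "\<not> lie_isomorphic UNIV br so3 commutator"
      by (rule not_isomorphic_real_weight[OF R[OF m] milnor_so3 _ lie_algebra_so_alg]) simp
    then show ?thesis
      using frame_indefinite[OF False] milnor_isomorphic[OF lie m lie_algebra_so_alg milnor_so21] by simp
  qed
  then show "definite_on UNIV g \<longleftrightarrow> lie_isomorphic UNIV br so3 commutator"
    "indefinite g \<longleftrightarrow> lie_isomorphic UNIV br so21 commutator" by blast+
qed

context
  fixes c v
  assumes M1: "\<And>x. M x = (c * g v x) *\<^sub>R v"
begin

lemma L1: "L x = (c * g v v) *\<^sub>R x - (c * g v x) *\<^sub>R v"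
proof -
  have "s1 * g (M u1) u1 + s2 * g (M u2) u2 + s3 * g (M u3) u3 = c * g v v"
    unfolding frame_g[of v v] by (simp add: M1 g_simps algebra_simps)
  then show ?thesis by (simp add: L_eq M1)
qed

text \<open>Every covariant derivative is a multiple of the single operator
  \<open>y \<mapsto> v \<times> y\<close>, so any two commute; the factor \<open>g v x\<close>
  vanishes on brackets.\<close>

lemma rank_one_flat: "flat_metric br g"
  unfolding flat_metric_def
proof (intro exI conjI allI)
  show "levi_civita br g (bismut br g (\<lambda>x y z. 0))" by (rule levi_civita_bismut)
  have nab: "bismut br g (\<lambda>x y z. 0) x y = (c * g v x) *\<^sub>R cross v y" for x y
    by (simp add: bismut_eq[OF three_form_zero] M1 cross_simps)
  have "g v (br x y) = 0" for x y by (simp add: br_eq L1 g_simps)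
  then show "curvature br (bismut br g (\<lambda>x y z. 0)) x y z = 0" for x y z
    by (simp add: curvature_def nab cross_simps)
qed

text \<open>For null \<open>v\<close> the map \<open>L\<close> reduces to
  \<open>z \<mapsto> - c (g v z) v\<close>, so all brackets are multiples of \<open>v\<close>, and
  \<open>v\<close> is central since \<open>y \<times> v\<close> is orthogonal to \<open>v\<close>. A
  non-zero null vector also excludes definite metrics.\<close>

lemma rank_one_null:
  assumes "c \<noteq> 0" "v \<noteq> 0" "g v v = 0"
  shows "lie_isomorphic UNIV br heis commutator" "indefinite g"
proof -
  have "\<exists>x y. g (cross x y) v \<noteq> 0"
  proof (rule ccontr)
    assume "\<not> ?thesis"
    then have "g (cross x y) v = 0" for x y by blast
    from this[of u1 u2] this[of u2 u3] this[of u3 u1] have "g v u1 = 0" "g v u2 = 0" "g v u3 = 0"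
      using signs by (auto simp: cross_frame g_simps g_sym[of v])
    then have "v = 0" by (intro frame_eqI) (simp_all add: g_simps)
    then show False using assms by simp
  qed
  then obtain x y where xy: "g (cross x y) v \<noteq> 0" by blast
  have "g v (cross y v) = 0" "g v (cross v x) = 0" using g_sym[of v] by simp_all
  then have "milnor_basis UNIV br 0 0 (- (c * g v (cross x y))) x y v"
    using triple_basis3[OF xy] assms(3) by (simp add: milnor_basis_def br_eq L1)
  then have m: "milnor UNIV br 0 0 (- (c * g v (cross x y)))" unfolding milnor_def by blast
  moreover have "- (c * g v (cross x y)) \<noteq> 0" using assms xy g_sym[of v "cross x y"] by simp
  ultimately have "milnor UNIV br 0 0 1"
    using milnor_sgn[OF lie m] milnor_uminus[OF lie, of 0 0 "-1"] by (auto simp: sgn_if split: if_splits)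
  then show "lie_isomorphic UNIV br heis commutator"
    by (rule milnor_isomorphic[OF lie _ lie_algebra_heis milnor_heis])
  have "\<not> definite_on UNIV g" using assms unfolding definite_on_def by force
  then show "indefinite g" using frame_definite frame_indefinite by blast
qed

text \<open>\<open>L\<close> kills \<open>v\<close> and is multiplication by
  \<open>t = c g v v\<close> on its orthogonal complement. In the orthogonal basis \<open>v\<close>,
  \<open>a = v \<times> x\<close>, \<open>b = v \<times> a\<close> the Milnor constants are
  \<open>0, k t, t\<close>, while \<open>g b b = k g a a\<close>. Thus the sign of \<open>k\<close>
  decides both between \<open>e(2)\<close> and \<open>e(1,1)\<close> and whether \<open>g\<close> is
  definite on the derived algebra \<open>span {a, b}\<close>.\<close>

lemma rank_one_nonnull:
  assumes c: "c \<noteq> 0" and v: "g v v \<noteq> 0"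
  shows "metabelian UNIV br"
    and "lie_isomorphic UNIV br e2 e_bracket \<or> lie_isomorphic UNIV br e11 e_bracket"
    and "definite_on (derived_algebra UNIV br) g \<longleftrightarrow> lie_isomorphic UNIV br e2 e_bracket"
proof -
  define s where "s = s1 * s2 * s3"
  have s: "s * s = 1" "s \<noteq> 0" using signs by (auto simp: s_def)
  note cross_cross' = cross_cross[folded s_def] and g_cross_cross' = g_cross_cross[folded s_def]
  \<comment> \<open>Otherwise \<open>(g v x)\<^sup>2 = g v v * g x x\<close> for all
    \<open>x\<close>; summing over the frame with signs yields
    \<open>g v v = 3 g v v\<close>.\<close>
  have "\<exists>x. g (cross v x) (cross v x) \<noteq> 0"
  proof (rule ccontr)
    assume "\<not> ?thesis"
    then have "g v x * g v x = g v v * g x x" for x using s(2) by (simp add: g_cross_cross')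
    from this[of u1] this[of u2] this[of u3]
    have *: "g v u1 * g v u1 = g v v * s1" "g v u2 * g v u2 = g v v * s2" "g v u3 * g v u3 = g v v * s3"
      by simp_all
    have "g v v = s1 * (g v u1 * g v u1) + s2 * (g v u2 * g v u2) + s3 * (g v u3 * g v u3)"
      by (subst frame_g) (simp only: mult.assoc)
    also have "\<dots> = 3 * g v v" unfolding * using signs by auto
    finally have "g v v = 3 * g v v" .
    then show False using v by simp
  qed
  then obtain x where x: "g (cross v x) (cross v x) \<noteq> 0" by blast
  define a where "a = cross v x"
  define b where "b = cross v a"
  define k where "k = s * g v v"
  define t where "t = c * g v v"
  have k: "k \<noteq> 0" and t: "t \<noteq> 0" using c v s by (simp_all add: k_def t_def)
  have aa: "g a a \<noteq> 0" using x by (simp add: a_def)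
  have va: "g v a = 0" "g a v = 0" using g_sym[of v a] by (simp_all add: a_def)
  have vb: "g v b = 0" "g b v = 0" "g a b = 0" "g b a = 0"
    using g_sym[of v b] g_sym[of a b] by (simp_all add: b_def)
  have bb: "g b b = k * g a a" by (simp add: b_def g_cross_cross' va k_def)
  have ab: "cross a b = (s * g a a) *\<^sub>R v"
    using cross_skew[of a b] by (simp add: b_def cross_cross' va)
  have bv: "cross b v = k *\<^sub>R a" by (simp add: b_def cross_cross' va k_def)
  have "g (cross v a) b \<noteq> 0" using k aa bb by (simp add: b_def[symmetric])
  then have "basis3 UNIV v a b" by (rule triple_basis3)
  then have mb: "milnor_basis UNIV br 0 (k * t) t v a b"
    by (simp add: milnor_basis_def br_eq ab bv b_def[symmetric] linear_scale[OF linear_L])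
      (simp add: L1 va vb t_def)
  then have m: "milnor UNIV br 0 (k * t) t" unfolding milnor_def by blast
  have kt: "k * t \<noteq> 0" using k t by simp
  show "metabelian UNIV br" by (rule milnor_derived_algebra(2)[OF lie mb kt t])
  have D: "derived_algebra UNIV br = span {a, b}" by (rule milnor_derived_algebra(1)[OF lie mb kt t])
  have gD: "g (q *\<^sub>R a + r *\<^sub>R b) (q *\<^sub>R a + r *\<^sub>R b) = (q\<^sup>2 + k * r\<^sup>2) * g a a" for q r
    by (simp add: g_simps vb bb power2_eq_square algebra_simps)
  note N = milnor_uminus[OF lie] and R = milnor_rotate[of UNIV br]
  have sg: "milnor UNIV br 0 (sgn k * sgn t) (sgn t)"
    using milnor_sgn[OF lie m] by (simp add: sgn_mult)
  show "lie_isomorphic UNIV br e2 e_bracket \<or> lie_isomorphic UNIV br e11 e_bracket"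
    and "definite_on (derived_algebra UNIV br) g \<longleftrightarrow> lie_isomorphic UNIV br e2 e_bracket"
  proof (atomize (full), cases "k > 0")
    case True
    have "milnor UNIV br 1 1 0"
      using R[OF sg] N[OF R[OF sg]] True t by (cases "t > 0") auto
    then have "lie_isomorphic UNIV br e2 e_bracket"
      by (rule milnor_isomorphic[OF lie _ lie_algebra_e_alg milnor_e2])
    moreover have "definite_on (span {a, b}) g"
    proof -
      have "\<exists>w>0. g u u = w * g a a" if u_in: "u \<in> span {a, b}" and "u \<noteq> 0" for u
      proof -
        obtain q where "u - q *\<^sub>R a \<in> span {b}" using u_in span_breakdown_eq[of u a "{b}"] by blast
        then obtain r where "u - q *\<^sub>R a = r *\<^sub>R b" by (auto simp: span_singleton)
        then have u: "u = q *\<^sub>R a + r *\<^sub>R b" by (simp add: algebra_simps)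
        then have "q \<noteq> 0 \<or> r \<noteq> 0" using that(2) by auto
        then have "q\<^sup>2 + k * r\<^sup>2 > 0"
          using True by (metis add_nonneg_pos add_pos_nonneg less_imp_le mult_nonneg_nonneg mult_pos_pos
              zero_le_power2 zero_less_power2)
        then show ?thesis using gD u by blast
      qed
      then show ?thesis
        using aa unfolding definite_on_def
        by (metis mult_pos_neg mult_pos_pos linorder_neqE_linordered_idom)
    qed
    ultimately show "(lie_isomorphic UNIV br e2 e_bracket \<or> lie_isomorphic UNIV br e11 e_bracket) \<and>
      (definite_on (derived_algebra UNIV br) g \<longleftrightarrow> lie_isomorphic UNIV br e2 e_bracket)"
      by (simp add: D)
  next
    case False
    then have k0: "k < 0" using k by simp
    have m: "milnor UNIV br 1 (- 1) 0"
      using R[OF sg] N[OF R[OF sg]] k0 t by (cases "t > 0") auto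
    have "lie_isomorphic UNIV br e11 e_bracket"
      by (rule milnor_isomorphic[OF lie m lie_algebra_e_alg milnor_e11])
    moreover have "\<not> lie_isomorphic UNIV br e2 e_bracket"
      by (rule not_isomorphic_real_weight[OF m milnor_e2 _ lie_algebra_e_alg]) simp
    moreover have "\<not> definite_on (span {a, b}) g"
    proof -
      have "a \<in> span {a, b}" "b \<in> span {a, b}" by (auto intro: span_base)
      moreover have "a \<noteq> 0" "b \<noteq> 0" using aa bb k by (auto simp: g_simps)
      moreover have "g a a > 0 \<longleftrightarrow> g b b < 0" "g a a < 0 \<longleftrightarrow> g b b > 0"
        using aa k0 by (auto simp: bb mult_less_0_iff zero_less_mult_iff)
      ultimately show ?thesis unfolding definite_on_def by (metis less_asym)
    qed
    ultimately show "(lie_isomorphic UNIV br e2 e_bracket \<or> lie_isomorphic UNIV br e11 e_bracket) \<and>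
      (definite_on (derived_algebra UNIV br) g \<longleftrightarrow> lie_isomorphic UNIV br e2 e_bracket)"
      by (simp add: D)
  qed
qed

end

lemma einstein_classification:
  assumes einstein: "gen_einstein br H g 0"
  shows "(lie_abelian UNIV br \<and> H = (\<lambda>_ _ _. 0) \<and> flat_metric br g)
      \<or> (lie_simple UNIV br \<and> H \<noteq> (\<lambda>_ _ _. 0) \<and> (\<exists>c. c \<noteq> 0 \<and> constant_curvature br g c) \<and>
          (definite_on UNIV g \<longleftrightarrow> lie_isomorphic UNIV br so3 commutator) \<and>
          (indefinite g \<longleftrightarrow> lie_isomorphic UNIV br so21 commutator))
      \<or> (H = (\<lambda>_ _ _. 0) \<and> flat_metric br g \<and> metabelian UNIV br \<and>
          (lie_isomorphic UNIV br e2 e_bracket \<or> lie_isomorphic UNIV br e11 e_bracket) \<and>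
          (definite_on (derived_algebra UNIV br) g \<longleftrightarrow> lie_isomorphic UNIV br e2 e_bracket))
      \<or> (lie_isomorphic UNIV br heis commutator \<and> H = (\<lambda>_ _ _. 0) \<and>
          flat_metric br g \<and> indefinite g)"
proof (cases "H u1 u2 u3 = 0")
  case False
  obtain c where "c \<noteq> 0" "\<And>x. M x = c *\<^sub>R x" by (rule einstein_scalar[OF einstein False]) blast
  then show ?thesis using scalar_case[of c] False by auto
next
  case True
  have "three_form H" using einstein by (simp add: gen_einstein_def)
  then have H: "H = (\<lambda>_ _ _. 0)" using three_form_eq[of H] True by (intro ext) simp
  obtain c v where M: "\<And>x. M x = (c * g v x) *\<^sub>R v" by (rule einstein_rank_one[OF einstein True]) blast
  note flat = rank_one_flat[OF M]
  consider "c = 0 \<or> v = 0" | "c \<noteq> 0" "v \<noteq> 0" "g v v = 0" | "c \<noteq> 0" "g v v \<noteq> 0" by blast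
  then show ?thesis
  proof cases
    case 1
    then have "lie_abelian UNIV br" by (auto simp: lie_abelian_def br_eq L1[OF M] g_simps)
    then show ?thesis using H flat by simp
  next
    case 2
    then show ?thesis using rank_one_null[OF M] H flat by simp
  next
    case 3
    then show ?thesis using rank_one_nonnull[OF M] H flat by simp
  qed
qed

end

section \<open>Existence of frames and the classification theorem\<close>

lemma exists_unimodular_frame:
  fixes br :: "'a::euclidean_space \<Rightarrow> 'a \<Rightarrow> 'a"
  assumes dim: "DIM('a) = 3" and lie: "lie_algebra UNIV br" and unimod: "unimodular UNIV br"
    and g: "pseudo_metric g"
  shows "\<exists>u1 u2 u3 s1 s2 s3. unimodular_frame br g u1 u2 u3 s1 s2 s3"
proof -
  interpret metric_lie_algebra br g by unfold_locales (rule lie g)+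
  obtain x y z where sp: "span {x, y, z} = UNIV" and o: "g x y = 0" "g y z = 0" "g z x = 0"
    by (rule exists_orthogonal_basis3[OF dim g_bil g_sym])
  have b: "basis3 UNIV x y z" by (rule basis3_of_span[OF dim sp])
  \<comment> \<open>A null member of an orthogonal basis would be orthogonal to everything,
    contradicting non-degeneracy.\<close>
  have nz: "g x x \<noteq> 0" if b: "basis3 UNIV x y z" and o: "g x y = 0" "g x z = 0" for x y z
  proof
    assume "g x x = 0"
    have "g x w = 0" for w
    proof -
      obtain p q r where "w = p *\<^sub>R x + q *\<^sub>R y + r *\<^sub>R z" using basis3_expand[OF b] by blast
      then show ?thesis using o \<open>g x x = 0\<close> by (simp add: g_simps)
    qed
    then have "x = 0" by (rule pseudo_metricD(3)[OF g])
    then show False using basis3_zero[OF b, of 1 0 0] by simp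
  qed
  have n: "g x x \<noteq> 0" "g y y \<noteq> 0" "g z z \<noteq> 0"
    using nz[OF b] nz[OF basis3_rotate[OF b]] nz[OF basis3_rotate[OF basis3_rotate[OF b]]] o g_sym by metis+
  define m where "m u = 1 / sqrt \<bar>g u u\<bar>" for u
  have m: "m u \<noteq> 0" "m u * (m u * g u u) = sgn (g u u)" if "g u u \<noteq> 0" for u
  proof -
    have "m u * m u = 1 / \<bar>g u u\<bar>" by (simp add: m_def)
    then have "m u * (m u * g u u) = g u u / \<bar>g u u\<bar>" by (metis mult.assoc mult_1 times_divide_eq_left)
    then show "m u * (m u * g u u) = sgn (g u u)" by (simp add: sgn_if)
    show "m u \<noteq> 0" using that by (simp add: m_def)
  qed
  have "span {m x *\<^sub>R x, m y *\<^sub>R y, m z *\<^sub>R z} = UNIV"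
  proof -
    have "w \<in> span {m x *\<^sub>R x, m y *\<^sub>R y, m z *\<^sub>R z}" for w
    proof -
      obtain p q r where "w = p *\<^sub>R x + q *\<^sub>R y + r *\<^sub>R z" using basis3_expand[OF b] by blast
      then have "w = (p / m x) *\<^sub>R m x *\<^sub>R x + (q / m y) *\<^sub>R m y *\<^sub>R y + (r / m z) *\<^sub>R m z *\<^sub>R z"
        using m(1) n by simp
      then show ?thesis unfolding span3 by blast
    qed
    then show ?thesis by auto
  qed
  then have "unimodular_frame br g (m x *\<^sub>R x) (m y *\<^sub>R y) (m z *\<^sub>R z) (sgn (g x x)) (sgn (g y y)) (sgn (g z z))"
    using n unimod by unfold_locales (auto simp: g_simps o m sgn_if)
  then show ?thesis by blast
qed

lemma unimodular_milnor:
  fixes br :: "'a::euclidean_space \<Rightarrow> 'a \<Rightarrow> 'a"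
  assumes "DIM('a) = 3" "lie_algebra UNIV br" "unimodular UNIV br"
  shows "\<exists>a b c. milnor UNIV br a b c"
proof -
  have "pseudo_metric ((\<bullet>) :: 'a \<Rightarrow> 'a \<Rightarrow> real)"
    by (auto simp: pseudo_metric_def bilinear_def inner_simps inner_commute intro!: linearI)
  then obtain u1 u2 u3 s1 s2 s3 where "unimodular_frame br (\<bullet>) u1 u2 u3 s1 s2 s3"
    using exists_unimodular_frame[OF assms] by blast
  then show ?thesis by (rule unimodular_frame.exists_milnor)
qed

theorem theorem1p2:
  fixes br :: "'a::euclidean_space \<Rightarrow> 'a \<Rightarrow> 'a"
  assumes dim3: "DIM('a) = 3"
    and lie: "lie_algebra UNIV br"
    and unimod: "unimodular UNIV br"
  shows
    "(\<forall>H g. gen_einstein br H g 0 \<longrightarrow>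
        (lie_abelian UNIV br \<and> H = (\<lambda>_ _ _. 0) \<and> flat_metric br g)
      \<or> (lie_simple UNIV br \<and> H \<noteq> (\<lambda>_ _ _. 0) \<and> (\<exists>c. c \<noteq> 0 \<and> constant_curvature br g c) \<and>
          (definite_on UNIV g \<longleftrightarrow> lie_isomorphic UNIV br so3 commutator) \<and>
          (indefinite g \<longleftrightarrow> lie_isomorphic UNIV br so21 commutator))
      \<or> (H = (\<lambda>_ _ _. 0) \<and> flat_metric br g \<and> metabelian UNIV br \<and>
          (lie_isomorphic UNIV br e2 e_bracket \<or> lie_isomorphic UNIV br e11 e_bracket) \<and>
          (definite_on (derived_algebra UNIV br) g \<longleftrightarrow> lie_isomorphic UNIV br e2 e_bracket))
      \<or> (lie_isomorphic UNIV br heis commutator \<and> H = (\<lambda>_ _ _. 0) \<and>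
          flat_metric br g \<and> indefinite g))
    \<and> (lie_abelian UNIV br \<longrightarrow>
        (\<forall>g. pseudo_metric g \<longrightarrow> gen_einstein br (\<lambda>_ _ _. 0) g 0))
    \<and> (lie_isomorphic UNIV br (UNIV :: (real^3) set) zero_bracket
      \<or> lie_isomorphic UNIV br so3 commutator
      \<or> lie_isomorphic UNIV br so21 commutator
      \<or> lie_isomorphic UNIV br e2 e_bracket
      \<or> lie_isomorphic UNIV br e11 e_bracket
      \<or> lie_isomorphic UNIV br heis commutator)
    \<and> (lie_algebra (UNIV :: (real^3) set) zero_bracket \<and> dim (UNIV :: (real^3) set) = 3 \<and>
        unimodular (UNIV :: (real^3) set) zero_bracket)
    \<and> (lie_algebra so3 commutator \<and> dim so3 = 3 \<and> unimodular so3 commutator)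
    \<and> (lie_algebra so21 commutator \<and> dim so21 = 3 \<and> unimodular so21 commutator)
    \<and> (lie_algebra e2 e_bracket \<and> dim e2 = 3 \<and> unimodular e2 e_bracket)
    \<and> (lie_algebra e11 e_bracket \<and> dim e11 = 3 \<and> unimodular e11 e_bracket)
    \<and> (lie_algebra heis commutator \<and> dim heis = 3 \<and> unimodular heis commutator)"
proof (intro conjI)
  show "\<forall>H g. gen_einstein br H g 0 \<longrightarrow>
        (lie_abelian UNIV br \<and> H = (\<lambda>_ _ _. 0) \<and> flat_metric br g)
      \<or> (lie_simple UNIV br \<and> H \<noteq> (\<lambda>_ _ _. 0) \<and> (\<exists>c. c \<noteq> 0 \<and> constant_curvature br g c) \<and>
          (definite_on UNIV g \<longleftrightarrow> lie_isomorphic UNIV br so3 commutator) \<and>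
          (indefinite g \<longleftrightarrow> lie_isomorphic UNIV br so21 commutator))
      \<or> (H = (\<lambda>_ _ _. 0) \<and> flat_metric br g \<and> metabelian UNIV br \<and>
          (lie_isomorphic UNIV br e2 e_bracket \<or> lie_isomorphic UNIV br e11 e_bracket) \<and>
          (definite_on (derived_algebra UNIV br) g \<longleftrightarrow> lie_isomorphic UNIV br e2 e_bracket))
      \<or> (lie_isomorphic UNIV br heis commutator \<and> H = (\<lambda>_ _ _. 0) \<and>
          flat_metric br g \<and> indefinite g)"
  proof (intro allI impI)
    fix H g assume E: "gen_einstein br H g 0"
    then have "pseudo_metric g" by (simp add: gen_einstein_def)
    then obtain u1 u2 u3 s1 s2 s3 where "unimodular_frame br g u1 u2 u3 s1 s2 s3"
      using exists_unimodular_frame[OF dim3 lie unimod] by blast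
    from unimodular_frame.einstein_classification[OF this E] show "(lie_abelian UNIV br \<and> H = (\<lambda>_ _ _. 0) \<and> flat_metric br g)
      \<or> (lie_simple UNIV br \<and> H \<noteq> (\<lambda>_ _ _. 0) \<and> (\<exists>c. c \<noteq> 0 \<and> constant_curvature br g c) \<and>
          (definite_on UNIV g \<longleftrightarrow> lie_isomorphic UNIV br so3 commutator) \<and>
          (indefinite g \<longleftrightarrow> lie_isomorphic UNIV br so21 commutator))
      \<or> (H = (\<lambda>_ _ _. 0) \<and> flat_metric br g \<and> metabelian UNIV br \<and>
          (lie_isomorphic UNIV br e2 e_bracket \<or> lie_isomorphic UNIV br e11 e_bracket) \<and>
          (definite_on (derived_algebra UNIV br) g \<longleftrightarrow> lie_isomorphic UNIV br e2 e_bracket))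
      \<or> (lie_isomorphic UNIV br heis commutator \<and> H = (\<lambda>_ _ _. 0) \<and>
          flat_metric br g \<and> indefinite g)" .
  qed
  show "lie_abelian UNIV br \<longrightarrow> (\<forall>g. pseudo_metric g \<longrightarrow> gen_einstein br (\<lambda>_ _ _. 0) g 0)"
    by (simp add: abelian_gen_einstein)
  show "lie_isomorphic UNIV br (UNIV :: (real^3) set) zero_bracket
      \<or> lie_isomorphic UNIV br so3 commutator
      \<or> lie_isomorphic UNIV br so21 commutator
      \<or> lie_isomorphic UNIV br e2 e_bracket
      \<or> lie_isomorphic UNIV br e11 e_bracket
      \<or> lie_isomorphic UNIV br heis commutator"
  proof -
    obtain a b c where "milnor UNIV br a b c" using unimodular_milnor[OF dim3 lie unimod] by blast
    note iso = milnor_isomorphic[OF lie]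
    from milnor_classification[OF lie \<open>milnor UNIV br a b c\<close>] show ?thesis
      using iso[OF _ lie_algebra_zero_bracket milnor_zero_bracket]
        iso[OF _ lie_algebra_so_alg milnor_so3] iso[OF _ lie_algebra_so_alg milnor_so21]
        iso[OF _ lie_algebra_e_alg milnor_e2] iso[OF _ lie_algebra_e_alg milnor_e11]
        iso[OF _ lie_algebra_heis milnor_heis] by blast
  qed
qed (rule lie_algebra_so_alg lie_algebra_e_alg lie_algebra_heis lie_algebra_zero_bracket
    milnor_dim[OF milnor_zero_bracket] milnor_dim[OF milnor_so3] milnor_dim[OF milnor_so21]
    milnor_dim[OF milnor_e2] milnor_dim[OF milnor_e11] milnor_dim[OF milnor_heis]
    milnor_unimodular[OF lie_algebra_zero_bracket milnor_zero_bracket]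
    milnor_unimodular[OF lie_algebra_so_alg milnor_so3] milnor_unimodular[OF lie_algebra_so_alg milnor_so21]
    milnor_unimodular[OF lie_algebra_e_alg milnor_e2] milnor_unimodular[OF lie_algebra_e_alg milnor_e11]
    milnor_unimodular[OF lie_algebra_heis milnor_heis])+

end
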